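(* There is an algorithm that, given a strongly chordal graph $G$ with $n\ge 3$ vertices and $m$ edges together with a strong elimination order of $G$, determines in $O(n+m)$ time whether $G$ has a locally connected spanning tree, and produces one if the answer is positive.
   Context: All graphs are finite and simple. A graph is chordal if every cycle of length greater than three has a chord; it is strongly chordal if it is chordal and every cycle of even length at least six has a chord dividing the cycle into two paths of odd length. For an ordering $(v_1,\ldots,v_n)$ of $V(G)$, $G_i$ is the subgraph induced by $\{v_i,\ldots,v_n\}$ and $N_{G_i}[v]$ is the closed neighborhood of $v$ in $G_i$. A strong elimination order is an ordering $(v_1,\ldots,v_n)$ of $V(G)$ such that $N_{G_i}[v_j]\subseteq N_{G_i}[v_k]$ whenever $i\le j\le k$ and $v_j,v_k\in N_{G_i}[v_i]$. A locally connected spanning tree of $G$ is a spanning tree $T$ of $G$ such that for every vertex $v$, the set of neighbors of $v$ in $T$ induces a connected subgraph of $G$. *)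

theory Defs
  imports Main
begin

section \<open>Graphs\<close>

definition simple_graph :: "'a set \<Rightarrow> 'a set set \<Rightarrow> bool" where
  "simple_graph V E \<longleftrightarrow> finite V \<and> (\<forall>e\<in>E. e \<subseteq> V \<and> card e = 2)"

definition neighbors :: "'a set set \<Rightarrow> 'a \<Rightarrow> 'a set" where
  "neighbors E v = {u. {u, v} \<in> E}"

definition closed_neighborhood :: "'a set set \<Rightarrow> 'a \<Rightarrow> 'a set" where
  "closed_neighborhood E v = insert v (neighbors E v)"

definition induced_edges :: "'a set set \<Rightarrow> 'a set \<Rightarrow> 'a set set" where
  "induced_edges E S = {e \<in> E. e \<subseteq> S}"

definition connected_graph :: "'a set \<Rightarrow> 'a set set \<Rightarrow> bool" where
  "connected_graph V E \<longleftrightarrow>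
     V \<noteq> {} \<and> (\<forall>u\<in>V. \<forall>v\<in>V. (u, v) \<in> {(x, y). {x, y} \<in> E}\<^sup>*)"

definition is_cycle :: "'a set set \<Rightarrow> 'a list \<Rightarrow> bool" where
  "is_cycle E c \<longleftrightarrow>
     3 \<le> length c \<and> distinct c \<and> (\<forall>i<length c. {c ! i, c ! (Suc i mod length c)} \<in> E)"

text \<open>The chord joining positions \<open>i < j\<close> divides the cycle \<open>c\<close> into two paths, of
  lengths \<open>j - i\<close> and \<open>length c - (j - i)\<close>.\<close>

definition is_chord :: "'a set set \<Rightarrow> 'a list \<Rightarrow> nat \<Rightarrow> nat \<Rightarrow> bool" where
  "is_chord E c i j \<longleftrightarrow>
     i < j \<and> j < length c \<and> {c ! i, c ! j} \<in> E \<and>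
     j \<noteq> Suc i \<and> \<not> (i = 0 \<and> Suc j = length c)"

definition chordal :: "'a set set \<Rightarrow> bool" where
  "chordal E \<longleftrightarrow> (\<forall>c. is_cycle E c \<and> 3 < length c \<longrightarrow> (\<exists>i j. is_chord E c i j))"

definition strongly_chordal :: "'a set set \<Rightarrow> bool" where
  "strongly_chordal E \<longleftrightarrow>
     chordal E \<and>
     (\<forall>c. is_cycle E c \<and> even (length c) \<and> 6 \<le> length c \<longrightarrow>
        (\<exists>i j. is_chord E c i j \<and> odd (j - i) \<and> odd (length c - (j - i))))"

text \<open>Positions are counted from 0, so \<open>vs ! i\<close> is the vertex usually written
  \<open>v\<close> with index \<open>i + 1\<close>.\<close>

definition suffix_edges :: "'a set set \<Rightarrow> 'a list \<Rightarrow> nat \<Rightarrow> 'a set set" where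
  "suffix_edges E vs i = induced_edges E (set (drop i vs))"

definition strong_elimination_order :: "'a set \<Rightarrow> 'a set set \<Rightarrow> 'a list \<Rightarrow> bool" where
  "strong_elimination_order V E vs \<longleftrightarrow>
     distinct vs \<and> set vs = V \<and>
     (\<forall>i j k. i \<le> j \<and> j \<le> k \<and> k < length vs \<and>
        vs ! j \<in> closed_neighborhood (suffix_edges E vs i) (vs ! i) \<and>
        vs ! k \<in> closed_neighborhood (suffix_edges E vs i) (vs ! i) \<longrightarrow>
        closed_neighborhood (suffix_edges E vs i) (vs ! j)
          \<subseteq> closed_neighborhood (suffix_edges E vs i) (vs ! k))"

definition spanning_tree :: "'a set \<Rightarrow> 'a set set \<Rightarrow> 'a set set \<Rightarrow> bool" where
  "spanning_tree V E T \<longleftrightarrow> T \<subseteq> E \<and> connected_graph V T \<and> (\<nexists>c. is_cycle T c)"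

definition locally_connected_spanning_tree :: "'a set \<Rightarrow> 'a set set \<Rightarrow> 'a set set \<Rightarrow> bool" where
  "locally_connected_spanning_tree V E T \<longleftrightarrow>
     spanning_tree V E T \<and>
     (\<forall>v\<in>V. connected_graph (neighbors T v) (induced_edges E (neighbors T v)))"


section \<open>A random access machine\<close>

text \<open>
  Programs are while programs over registers and arrays of natural numbers. The instruction
  set is that of the usual random access machine with addition and (truncated) subtraction:
  a program mentions finitely many registers and arrays, so the arrays can be interleaved in
  one random access memory at the price of a constant factor.

  Every operation, including each register access, memory access and arithmetic operation
  inside an expression, costs at least one time unit. Unit cost is justified by a word bound:
  \<open>exec W\<close> gets stuck as soon as a value (in particular an address) greater than \<open>W\<close> is read
  or computed.
\<close>

record state =
  reg :: "string \<Rightarrow> nat"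
  arr :: "string \<Rightarrow> nat \<Rightarrow> nat"

datatype aexp = Const nat | Reg string | Load string aexp | Plus aexp aexp | Minus aexp aexp

datatype bexp = Less aexp aexp | Eq aexp aexp | Neg bexp | And bexp bexp

datatype com =
    Skip
  | Assign string aexp
  | Store string aexp aexp
  | Seq com com
  | Cond bexp com com
  | While bexp com

fun aval :: "aexp \<Rightarrow> state \<Rightarrow> nat" where
  "aval (Const k) s = k"
| "aval (Reg x) s = reg s x"
| "aval (Load a e) s = arr s a (aval e s)"
| "aval (Plus e1 e2) s = aval e1 s + aval e2 s"
| "aval (Minus e1 e2) s = aval e1 s - aval e2 s"

fun afits :: "nat \<Rightarrow> aexp \<Rightarrow> state \<Rightarrow> bool" where
  "afits W (Const k) s \<longleftrightarrow> k \<le> W"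
| "afits W (Reg x) s \<longleftrightarrow> reg s x \<le> W"
| "afits W (Load a e) s \<longleftrightarrow> afits W e s \<and> arr s a (aval e s) \<le> W"
| "afits W (Plus e1 e2) s \<longleftrightarrow> afits W e1 s \<and> afits W e2 s \<and> aval e1 s + aval e2 s \<le> W"
| "afits W (Minus e1 e2) s \<longleftrightarrow> afits W e1 s \<and> afits W e2 s"

fun acost :: "aexp \<Rightarrow> nat" where
  "acost (Const k) = 1"
| "acost (Reg x) = 1"
| "acost (Load a e) = acost e + 1"
| "acost (Plus e1 e2) = acost e1 + acost e2 + 1"
| "acost (Minus e1 e2) = acost e1 + acost e2 + 1"

fun bval :: "bexp \<Rightarrow> state \<Rightarrow> bool" where
  "bval (Less e1 e2) s \<longleftrightarrow> aval e1 s < aval e2 s"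
| "bval (Eq e1 e2) s \<longleftrightarrow> aval e1 s = aval e2 s"
| "bval (Neg b) s \<longleftrightarrow> \<not> bval b s"
| "bval (And b1 b2) s \<longleftrightarrow> bval b1 s \<and> bval b2 s"

fun bfits :: "nat \<Rightarrow> bexp \<Rightarrow> state \<Rightarrow> bool" where
  "bfits W (Less e1 e2) s \<longleftrightarrow> afits W e1 s \<and> afits W e2 s"
| "bfits W (Eq e1 e2) s \<longleftrightarrow> afits W e1 s \<and> afits W e2 s"
| "bfits W (Neg b) s \<longleftrightarrow> bfits W b s"
| "bfits W (And b1 b2) s \<longleftrightarrow> bfits W b1 s \<and> bfits W b2 s"

fun bcost :: "bexp \<Rightarrow> nat" where
  "bcost (Less e1 e2) = acost e1 + acost e2 + 1"
| "bcost (Eq e1 e2) = acost e1 + acost e2 + 1"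
| "bcost (Neg b) = bcost b + 1"
| "bcost (And b1 b2) = bcost b1 + bcost b2 + 1"

text \<open>\<open>exec W c s t s'\<close>: started in \<open>s\<close>, the program \<open>c\<close> halts in \<open>s'\<close> after \<open>t\<close> time units,
  and no value greater than \<open>W\<close> occurs.\<close>

inductive exec :: "nat \<Rightarrow> com \<Rightarrow> state \<Rightarrow> nat \<Rightarrow> state \<Rightarrow> bool" for W where
  Skip: "exec W Skip s 1 s"
| Assign: "afits W e s \<Longrightarrow>
    exec W (Assign x e) s (acost e + 1) (s\<lparr>reg := (reg s)(x := aval e s)\<rparr>)"
| Store: "afits W i s \<Longrightarrow> afits W e s \<Longrightarrow>
    exec W (Store a i e) s (acost i + acost e + 1)
      (s\<lparr>arr := (arr s)(a := (arr s a)(aval i s := aval e s))\<rparr>)"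
| Seq: "exec W c1 s t1 s1 \<Longrightarrow> exec W c2 s1 t2 s2 \<Longrightarrow> exec W (Seq c1 c2) s (t1 + t2) s2"
| CondTrue: "bfits W b s \<Longrightarrow> bval b s \<Longrightarrow> exec W c1 s t s1 \<Longrightarrow>
    exec W (Cond b c1 c2) s (bcost b + t) s1"
| CondFalse: "bfits W b s \<Longrightarrow> \<not> bval b s \<Longrightarrow> exec W c2 s t s1 \<Longrightarrow>
    exec W (Cond b c1 c2) s (bcost b + t) s1"
| WhileFalse: "bfits W b s \<Longrightarrow> \<not> bval b s \<Longrightarrow> exec W (While b c) s (bcost b) s"
| WhileTrue: "bfits W b s \<Longrightarrow> bval b s \<Longrightarrow> exec W c s t1 s1 \<Longrightarrow>
    exec W (While b c) s1 t2 s2 \<Longrightarrow> exec W (While b c) s (bcost b + t1 + t2) s2"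

inductive_cases SkipE: "exec W Skip s t s'"
inductive_cases AssignE: "exec W (Assign x e) s t s'"
inductive_cases StoreE: "exec W (Store a i e) s t s'"
inductive_cases SeqE: "exec W (Seq c1 c2) s t s'"
inductive_cases CondE: "exec W (Cond b c1 c2) s t s'"
inductive_cases WhileE: "exec W (While b c) s t s'"

lemma exec_deterministic:
  "exec W c s t s1 \<Longrightarrow> exec W c s t' s2 \<Longrightarrow> t' = t \<and> s2 = s1"
proof (induction arbitrary: t' s2 rule: exec.induct)
  case Skip
  then show ?case by (auto elim: SkipE)
next
  case Assign
  from Assign.prems show ?case by (auto elim: AssignE)
next
  case Store
  from Store.prems show ?case by (auto elim: StoreE)
next
  case Seq
  from Seq.prems show ?case by (rule SeqE) (use Seq.IH in blast)
next
  case CondTrue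
  from CondTrue.prems show ?case by (rule CondE) (use CondTrue in blast)+
next
  case CondFalse
  from CondFalse.prems show ?case by (rule CondE) (use CondFalse in blast)+
next
  case WhileFalse
  from WhileFalse.prems show ?case by (rule WhileE) (use WhileFalse in blast)+
next
  case WhileTrue
  from WhileTrue.prems show ?case by (rule WhileE) (use WhileTrue in blast)+
qed


section \<open>Input and output\<close>

text \<open>
  The vertices are the numbers below \<open>n\<close>. The graph is given by adjacency lists, in which the
  neighbors of a vertex are listed in an arbitrary order. The lists are stored one after the
  other in the array \<open>adj\<close>; the list of \<open>v\<close> occupies the positions from \<open>offset[v]\<close> up to, but
  not including, \<open>offset[v + 1]\<close>. All other cells are initially 0.
\<close>

definition adjacency_lists :: "nat \<Rightarrow> nat set set \<Rightarrow> nat list list \<Rightarrow> bool" where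
  "adjacency_lists n E adj \<longleftrightarrow>
     length adj = n \<and> (\<forall>v<n. distinct (adj ! v) \<and> set (adj ! v) = neighbors E v)"

definition array_of :: "nat list \<Rightarrow> nat \<Rightarrow> nat" where
  "array_of xs = (\<lambda>i. if i < length xs then xs ! i else 0)"

definition input_state :: "nat \<Rightarrow> nat \<Rightarrow> nat list list \<Rightarrow> nat list \<Rightarrow> state" where
  "input_state n m adj vs =
     \<lparr>reg = (\<lambda>_. 0)(''n'' := n, ''m'' := m),
      arr = (\<lambda>_ _. 0)
        (''offset'' := array_of (map (\<lambda>v. length (concat (take v adj))) [0..<Suc n]),
         ''adj'' := array_of (concat adj),
         ''order'' := array_of vs)\<rparr>"

definition output_edges :: "nat \<Rightarrow> state \<Rightarrow> nat set set" where
  "output_edges n s = {{arr s ''end1'' i, arr s ''end2'' i} | i. i < n - 1}"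

end

theory Submission
  imports Defs
begin

text \<open>
  Write \<open>top v\<close> for the last position of a vertex in the closed neighborhood of \<open>v\<close>. A locally
  connected spanning tree exists iff the last two vertices are adjacent and every other vertex has
  at least two neighbors after it in the order.

  Necessity: a graph with a locally connected spanning tree stays connected when a vertex \<open>x\<close> is
  deleted, because the tree neighbors of \<open>x\<close> are connected to each other without \<open>x\<close>. Deleting
  simplicial vertices preserves this property, so it holds in every suffix graph.

  Sufficiency: let \<open>g\<close> be the first vertex of the closed neighborhood of \<open>u\<close> with
  \<open>top g > pos u\<close>, and let the parent of \<open>u\<close> be the vertex at position \<open>top g\<close>. Nestedness
  of the neighborhoods at \<open>g\<close> shows that every earlier neighbor \<open>w\<close> of \<open>u\<close> with
  \<open>top w > pos u\<close> is adjacent to the parent of \<open>u\<close>. Hence a child \<open>v\<close> of \<open>x\<close> is adjacent to a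
  later tree neighbor of \<open>x\<close>: to the parent of \<open>x\<close> if \<open>x\<close> is not the last neighbor of \<open>v\<close>,
  and otherwise to the second last neighbor of \<open>v\<close>, whose parent is \<open>x\<close>.
\<close>

section \<open>Graphs with a locally connected spanning tree\<close>

lemma in_induced_neighbors_rtrancl:
  assumes "(a, b) \<in> {(x, y). {x, y} \<in> induced_edges E S}\<^sup>*" "S \<subseteq> B"
  shows "(a, b) \<in> {(x, y). {x, y} \<in> E \<and> x \<in> B \<and> y \<in> B}\<^sup>*"
proof (rule set_rev_mp[OF assms(1)], rule rtrancl_mono)
  show "{(x, y). {x, y} \<in> induced_edges E S} \<subseteq> {(x, y). {x, y} \<in> E \<and> x \<in> B \<and> y \<in> B}"
    using assms(2) by (auto simp: induced_edges_def)
qed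

lemma sym_adjacency_rtrancl: "sym ({(x, y). {x, y} \<in> E \<and> x \<in> S \<and> y \<in> S}\<^sup>*)"
  by (rule sym_rtrancl) (auto simp: sym_def insert_commute)

text \<open>A tree path from \<open>u\<close> avoids \<open>x\<close> until it first steps onto
  \<open>x\<close>, and the vertex before that step is a tree neighbor of \<open>x\<close>. The
  disjunction is an invariant along the path: once its second half holds, it persists.\<close>

lemma tree_path_to_neighbor:
  assumes "(u, z) \<in> {(x, y). {x, y} \<in> T}\<^sup>*" "u \<noteq> x" "T \<subseteq> E" "\<And>e. e \<in> E \<Longrightarrow> e \<subseteq> V"
  shows "(z \<noteq> x \<and> (u, z) \<in> {(a, b). {a, b} \<in> E \<and> a \<in> V - {x} \<and> b \<in> V - {x}}\<^sup>*) \<or>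
    (\<exists>y\<in>neighbors T x. (u, y) \<in> {(a, b). {a, b} \<in> E \<and> a \<in> V - {x} \<and> b \<in> V - {x}}\<^sup>*)"
  using assms(1)
proof (induction rule: rtrancl_induct)
  case base
  then show ?case using assms(2) by auto
next
  case (step y z)
  have e: "{y, z} \<in> T" using step.hyps(2) by simp
  then have V: "{y, z} \<in> E" "y \<in> V" "z \<in> V" using assms(3,4) by blast+
  show ?case
  proof (cases "\<exists>y\<in>neighbors T x. (u, y) \<in> {(a, b). {a, b} \<in> E \<and> a \<in> V - {x} \<and> b \<in> V - {x}}\<^sup>*")
    case False
    then have y: "y \<noteq> x" and p: "(u, y) \<in> {(a, b). {a, b} \<in> E \<and> a \<in> V - {x} \<and> b \<in> V - {x}}\<^sup>*"
      using step.IH by auto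
    have "z \<noteq> x" using False p e by (auto simp: neighbors_def)
    then show ?thesis using p V y by (auto intro: rtrancl_into_rtrancl)
  qed auto
qed

lemma lcst_imp_vertex_deleted_connected:
  assumes T: "locally_connected_spanning_tree V E T" and g: "simple_graph V E"
    and x: "x \<in> V" and u: "u \<in> V - {x}" and w: "w \<in> V - {x}"
  shows "(u, w) \<in> {(a, b). {a, b} \<in> E \<and> a \<in> V - {x} \<and> b \<in> V - {x}}\<^sup>*" (is "_ \<in> ?R\<^sup>*")
proof -
  have sub: "\<And>e. e \<in> E \<Longrightarrow> e \<subseteq> V" and c2: "\<And>e. e \<in> E \<Longrightarrow> card e = 2"
    using g by (auto simp: simple_graph_def)
  have TE: "T \<subseteq> E" and con: "connected_graph V T"
    and loc: "connected_graph (neighbors T x) (induced_edges E (neighbors T x))"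
    using T x by (auto simp: locally_connected_spanning_tree_def spanning_tree_def)
  have reach: "\<exists>y\<in>neighbors T x. (a, y) \<in> ?R\<^sup>*" if "a \<in> V - {x}" for a
  proof -
    have "(a, x) \<in> {(x, y). {x, y} \<in> T}\<^sup>*" using con that x by (auto simp: connected_graph_def)
    from tree_path_to_neighbor[OF this _ TE sub] that show ?thesis by auto
  qed
  obtain y z where y: "y \<in> neighbors T x" "(u, y) \<in> ?R\<^sup>*" and z: "z \<in> neighbors T x" "(w, z) \<in> ?R\<^sup>*"
    using reach u w by meson
  \<comment> \<open>Edges have two distinct endpoints, so \<open>x\<close> is not its own tree
    neighbor, and local connectivity at \<open>x\<close> yields walks that avoid
    \<open>x\<close>.\<close>
  have "neighbors T x \<subseteq> V - {x}"
    using TE sub c2 by (fastforce simp: neighbors_def)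
  then have "(y, z) \<in> ?R\<^sup>*"
    using loc y(1) z(1) unfolding connected_graph_def by (intro in_induced_neighbors_rtrancl) blast+
  moreover have "(z, w) \<in> ?R\<^sup>*" using z(2) sym_adjacency_rtrancl by (rule symD[rotated])
  ultimately show ?thesis using y(2) by (meson rtrancl_trans)
qed

section \<open>The parent tree of a strong elimination order\<close>

locale strong_elimination =
  fixes V :: "'a set" and E :: "'a set set" and vs :: "'a list" and pos :: "'a \<Rightarrow> nat"
  assumes graph: "simple_graph V E"
    and order: "strong_elimination_order V E vs"
    and pos_nth: "i < length vs \<Longrightarrow> pos (vs ! i) = i"
begin

definition top_pos :: "'a \<Rightarrow> nat" where
  "top_pos v = Max (insert (pos v) (pos ` neighbors E v))"

text \<open>When \<open>pos u < top_pos u\<close>, the vertex \<open>u\<close> itself meets the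
  condition on \<open>w\<close>, so inserting \<open>pos u\<close> extends the minimum to the closed
  neighborhood. It also keeps the set nonempty.\<close>

definition guide :: "'a \<Rightarrow> nat" where
  "guide u = Min (insert (pos u) {pos w | w. w \<in> neighbors E u \<and> pos u < top_pos w})"

definition parent :: "'a \<Rightarrow> 'a" where
  "parent u = vs ! top_pos (vs ! guide u)"

text \<open>A neighbor strictly between \<open>v\<close> and its last neighbor witnesses two later neighbors of \<open>v\<close>;
  this form can be tested without counting.\<close>

definition two_higher_neighbors :: bool where
  "two_higher_neighbors \<longleftrightarrow>
     (\<forall>v\<in>V. pos v + 2 < length vs \<longrightarrow> (\<exists>u\<in>neighbors E v. pos v < pos u \<and> pos u < top_pos v)) \<and>
     top_pos (vs ! (length vs - 2)) = length vs - 1"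

text \<open>The last vertex is the root and contributes no edge. Indexing by position matches the
  layout of the output arrays.\<close>

definition parent_edges :: "'a set set" where
  "parent_edges = {{vs ! i, parent (vs ! i)} | i. i < length vs - 1}"

section \<open>Positions and nested neighborhoods\<close>

lemma distinct_vs: "distinct vs" and set_vs: "set vs = V"
  using order by (auto simp: strong_elimination_order_def)

lemma finite_V: "finite V" and edge_in_V: "{x, y} \<in> E \<Longrightarrow> x \<in> V \<and> y \<in> V"
  and edge_neq: "{x, y} \<in> E \<Longrightarrow> x \<noteq> y"
  using graph by (force simp: simple_graph_def)+

lemma nth_pos: "v \<in> V \<Longrightarrow> vs ! pos v = v" and pos_less: "v \<in> V \<Longrightarrow> pos v < length vs"
  unfolding set_vs[symmetric] by (auto simp: in_set_conv_nth pos_nth)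

lemma nth_in_V: "i < length vs \<Longrightarrow> vs ! i \<in> V"
  using set_vs by auto

lemma pos_inj: "x \<in> V \<Longrightarrow> y \<in> V \<Longrightarrow> pos x = pos y \<Longrightarrow> x = y"
  by (metis nth_pos)

lemma in_drop_iff: "x \<in> set (drop i vs) \<longleftrightarrow> x \<in> V \<and> i \<le> pos x"
proof
  assume "x \<in> set (drop i vs)"
  then obtain k where "k < length vs - i" "x = vs ! (i + k)"
    by (auto simp: in_set_conv_nth)
  then show "x \<in> V \<and> i \<le> pos x" by (simp add: pos_nth nth_in_V)
next
  assume *: "x \<in> V \<and> i \<le> pos x"
  then have "x = drop i vs ! (pos x - i)" "pos x - i < length (drop i vs)"
    using nth_pos[of x] pos_less[of x] by auto
  then show "x \<in> set (drop i vs)" by (metis nth_mem)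
qed

text \<open>The condition on the order with \<open>i\<close>, \<open>j\<close>, \<open>k\<close>
  taken as the positions of \<open>v\<close>, \<open>a\<close>, \<open>b\<close>, and closed
  neighborhoods unfolded to equality or adjacency. The bound on \<open>pos w\<close> keeps
  \<open>w\<close> in the suffix graph at \<open>v\<close>.\<close>

lemma nested:
  assumes "v \<in> V" "a \<in> V" "b \<in> V" "w \<in> V"
    and "pos v \<le> pos a" "pos a \<le> pos b" "pos v \<le> pos w"
    and "v = a \<or> {v, a} \<in> E" "v = b \<or> {v, b} \<in> E" "a = w \<or> {a, w} \<in> E"
  shows "b = w \<or> {b, w} \<in> E"
proof -
  have cl: "y \<in> closed_neighborhood (suffix_edges E vs (pos v)) (vs ! pos x) \<longleftrightarrow> x = y \<or> {x, y} \<in> E"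
    if "x \<in> V" "pos v \<le> pos x" "y \<in> V" "pos v \<le> pos y" for x y
    using that nth_pos[OF that(1)]
    by (auto simp: closed_neighborhood_def neighbors_def suffix_edges_def induced_edges_def
        in_drop_iff insert_commute)
  have "closed_neighborhood (suffix_edges E vs (pos v)) (vs ! pos a)
          \<subseteq> closed_neighborhood (suffix_edges E vs (pos v)) (vs ! pos b)"
    by (rule order[unfolded strong_elimination_order_def, THEN conjunct2, THEN conjunct2,
          rule_format, of "pos v" "pos a" "pos b"])
      (use assms cl[of v a] cl[of v b] nth_pos pos_less in simp_all)
  then show ?thesis using cl[of a w] cl[of b w] assms by auto
qed

text \<open>The earlier of \<open>a\<close> and \<open>b\<close> lies in its own closed
  neighborhood, hence by nestedness at \<open>v\<close> in that of the later one.\<close>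

lemma higher_neighbors_clique:
  assumes "{v, a} \<in> E" "{v, b} \<in> E" "pos v < pos a" "pos v < pos b" "a \<noteq> b"
  shows "{a, b} \<in> E"
proof -
  have V: "v \<in> V" "a \<in> V" "b \<in> V" using assms edge_in_V by blast+
  show ?thesis
  proof (cases "pos a \<le> pos b")
    case True
    then show ?thesis using nested[of v a b a] V assms by (auto simp: insert_commute)
  next
    case False
    then show ?thesis using nested[of v b a b] V assms by (auto simp: insert_commute)
  qed
qed

section \<open>Last neighbors, guides and parents\<close>

lemma finite_neighbors: "finite (neighbors E v)"
  by (rule finite_subset[OF _ finite_V]) (use edge_in_V in \<open>auto simp: neighbors_def\<close>)

lemma pos_le_top: "pos v \<le> top_pos v" and neighbor_pos_le_top: "{v, u} \<in> E \<Longrightarrow> pos u \<le> top_pos v"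
proof -
  have fin: "finite (insert (pos v) (pos ` neighbors E v))" using finite_neighbors by simp
  show "pos v \<le> top_pos v" unfolding top_pos_def by (rule Max_ge[OF fin]) simp
  assume "{v, u} \<in> E"
  then have "u \<in> neighbors E v" by (simp add: neighbors_def insert_commute)
  then show "pos u \<le> top_pos v" unfolding top_pos_def by (intro Max_ge[OF fin]) simp
qed

lemma top_vertex:
  assumes "v \<in> V"
  shows "top_pos v < length vs" "vs ! top_pos v = v \<or> {v, vs ! top_pos v} \<in> E"
proof -
  have "top_pos v \<in> insert (pos v) (pos ` neighbors E v)"
    unfolding top_pos_def using finite_neighbors by (intro Max_in) auto
  then obtain x where "x = v \<or> {v, x} \<in> E" "top_pos v = pos x"
    by (auto simp: neighbors_def insert_commute)
  then show "top_pos v < length vs" "vs ! top_pos v = v \<or> {v, vs ! top_pos v} \<in> E"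
    using assms edge_in_V[of v x] by (auto simp: nth_pos pos_less)
qed

lemma guide_properties:
  assumes "u \<in> V"
  shows "guide u \<le> pos u"
    and "w \<in> neighbors E u \<Longrightarrow> pos u < top_pos w \<Longrightarrow> guide u \<le> pos w"
    and "pos u < top_pos u \<Longrightarrow> \<exists>g\<in>V. pos g = guide u \<and> (g = u \<or> {g, u} \<in> E) \<and> pos u < top_pos g"
proof -
  let ?C = "{pos w | w. w \<in> neighbors E u \<and> pos u < top_pos w}"
  have fin: "finite ?C" using finite_neighbors by simp
  show "guide u \<le> pos u" "w \<in> neighbors E u \<Longrightarrow> pos u < top_pos w \<Longrightarrow> guide u \<le> pos w"
    unfolding guide_def using fin by (auto intro!: Min_le)
  have "guide u \<in> insert (pos u) ?C" unfolding guide_def using fin by (intro Min_in) auto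
  then show "pos u < top_pos u \<Longrightarrow> \<exists>g\<in>V. pos g = guide u \<and> (g = u \<or> {g, u} \<in> E) \<and> pos u < top_pos g"
    using assms edge_in_V by (auto simp: neighbors_def)
qed

lemma parent_properties:
  assumes "u \<in> V" "pos u < top_pos u"
  shows "parent u \<in> V" "pos u < pos (parent u)" "{u, parent u} \<in> E"
    and "{w, u} \<in> E \<Longrightarrow> pos w < pos u \<Longrightarrow> pos u < top_pos w \<Longrightarrow> {w, parent u} \<in> E"
proof -
  obtain g where g: "g \<in> V" "pos g = guide u" "g = u \<or> {g, u} \<in> E" "pos u < top_pos g"
    using guide_properties(3)[OF assms] by blast
  have p: "parent u = vs ! top_pos g" unfolding parent_def using g by (metis nth_pos)
  have t: "top_pos g < length vs" "vs ! top_pos g = g \<or> {g, vs ! top_pos g} \<in> E" using top_vertex g by auto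
  show pV: "parent u \<in> V" and pp: "pos u < pos (parent u)"
    using t g p by (auto simp: nth_in_V pos_nth)
  have gu: "pos g \<le> pos u" using guide_properties(1) assms(1) g(2) by simp
  \<comment> \<open>Both \<open>u\<close> and its parent lie in the closed neighborhood of
    \<open>g\<close>, and the parent is later, so nestedness at \<open>g\<close> makes every
    neighbor of \<open>u\<close> not before \<open>g\<close> a neighbor of the parent. Taking
    \<open>w = u\<close> gives the tree edge; for the last claim, minimality of the guide puts
    \<open>w\<close> at or after \<open>g\<close>.\<close>
  have *: "parent u = w \<or> {parent u, w} \<in> E"
    if "w \<in> V" "u = w \<or> {u, w} \<in> E" "pos g \<le> pos w" for w
    using nested[of g u "parent u" w] g t p pV pp gu assms(1) that by auto
  show "{u, parent u} \<in> E" using *[of u] assms(1) gu pp by (auto simp: insert_commute)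
  assume w: "{w, u} \<in> E" "pos w < pos u" "pos u < top_pos w"
  then have "pos g \<le> pos w" using guide_properties(2)[OF assms(1)] g(2) by (simp add: neighbors_def)
  then show "{w, parent u} \<in> E"
    using *[of w] w pp edge_in_V[of w u] by (auto simp: insert_commute)
qed

text \<open>A parent is later than its child, so positions orient every tree edge and exclude the
  reversed reading of the doubleton.\<close>

lemma parent_edge_iff:
  assumes "x \<in> V" "y \<in> V" "pos x \<le> pos y" "\<And>v. v \<in> V \<Longrightarrow> pos v < length vs - 1 \<Longrightarrow> pos v < top_pos v"
  shows "{x, y} \<in> parent_edges \<longleftrightarrow> pos x < length vs - 1 \<and> y = parent x"
proof
  assume "{x, y} \<in> parent_edges"
  then obtain i where i: "i < length vs - 1" "{x, y} = {vs ! i, parent (vs ! i)}"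
    by (auto simp: parent_edges_def)
  have "i < pos (parent (vs ! i))"
    using parent_properties(2)[of "vs ! i"] assms(4)[of "vs ! i"] i by (simp add: pos_nth nth_in_V)
  then show "pos x < length vs - 1 \<and> y = parent x"
    using i assms(3) pos_nth[of i] by (auto simp: doubleton_eq_iff)
next
  assume "pos x < length vs - 1 \<and> y = parent x"
  then show "{x, y} \<in> parent_edges" using nth_pos[OF assms(1)] by (force simp: parent_edges_def)
qed

section \<open>Sufficiency: the parent edges form a locally connected spanning tree\<close>

context
  assumes two: two_higher_neighbors and len: "2 \<le> length vs"
begin

lemma pos_less_top:
  assumes "v \<in> V" "pos v < length vs - 1"
  shows "pos v < top_pos v"
proof (cases "pos v + 2 < length vs")
  case True
  then show ?thesis using two assms by (auto simp: two_higher_neighbors_def)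
next
  case False
  then have "pos v = length vs - 2" using assms by simp
  then have "vs ! (length vs - 2) = v" using nth_pos[OF assms(1)] by metis
  then show ?thesis using two assms by (auto simp: two_higher_neighbors_def)
qed

lemmas parent_edges_iff = parent_edge_iff[OF _ _ _ pos_less_top]

lemma parent_edges_subset: "parent_edges \<subseteq> E"
proof -
  have "{vs ! i, parent (vs ! i)} \<in> E" if "i < length vs - 1" for i
    using parent_properties(3)[of "vs ! i"] pos_less_top[of "vs ! i"] that
    by (simp add: pos_nth nth_in_V)
  then show ?thesis by (auto simp: parent_edges_def)
qed

text \<open>Passing to the parent raises the position, so every vertex climbs to the last one; the
  induction is on the distance to the end of the order.\<close>

lemma parent_edges_connected: "connected_graph V parent_edges"
proof -
  let ?R = "{(x, y). {x, y} \<in> parent_edges}"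
  let ?r = "vs ! (length vs - 1)"
  have sym: "sym (?R\<^sup>*)" by (rule sym_rtrancl) (auto simp: sym_def insert_commute)
  have "(v, ?r) \<in> ?R\<^sup>*" if "v \<in> V" for v
    using that
  proof (induction "length vs - pos v" arbitrary: v rule: less_induct)
    case less
    show ?case
    proof (cases "pos v < length vs - 1")
      case True
      note p = parent_properties[OF less.prems pos_less_top[OF less.prems True]]
      have "{v, parent v} \<in> parent_edges" using parent_edges_iff less.prems p True by simp
      moreover have "(parent v, ?r) \<in> ?R\<^sup>*" using less.hyps[of "parent v"] p pos_less[OF p(1)] by simp
      ultimately show ?thesis by (auto intro: converse_rtrancl_into_rtrancl)
    next
      case False
      then have "pos v = length vs - 1" using pos_less[OF less.prems] by simp
      then show ?thesis using nth_pos[OF less.prems] by auto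
    qed
  qed
  moreover have "V \<noteq> {}" using len set_vs by auto
  ultimately show ?thesis
    unfolding connected_graph_def using symD[OF sym] by (blast intro: rtrancl_trans)
qed

text \<open>Both cyclic neighbors of the earliest vertex on a cycle would be its parent, hence
  equal, which a length of at least three forbids.\<close>

lemma parent_edges_acyclic: "\<not> is_cycle parent_edges c"
proof
  assume c: "is_cycle parent_edges c"
  let ?l = "length c"
  have l: "3 \<le> ?l" and d: "distinct c"
    and e: "\<And>i. i < ?l \<Longrightarrow> {c ! i, c ! (Suc i mod ?l)} \<in> parent_edges"
    using c by (auto simp: is_cycle_def)
  have cV: "c ! i \<in> V" if "i < ?l" for i using e[OF that] parent_edges_subset edge_in_V by blast
  obtain k where k: "k < ?l" "\<And>i. i < ?l \<Longrightarrow> pos (c ! k) \<le> pos (c ! i)"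
    using arg_min_nat_lemma[of "\<lambda>i. i < ?l" 0 "\<lambda>i. pos (c ! i)"] l by fastforce
  \<comment> \<open>The cyclic predecessor of \<open>k\<close>; the case split keeps
    \<open>Suc j mod ?l = k\<close> valid for \<open>k = 0\<close>.\<close>
  define j where "j = (if k = 0 then ?l - 1 else k - 1)"
  have j: "j < ?l" "Suc j mod ?l = k" using k(1) l by (auto simp: j_def)
  have s: "Suc k mod ?l < ?l" using k(1) by (intro mod_less_divisor) linarith
  have "c ! (Suc k mod ?l) = parent (c ! k)"
    using parent_edges_iff[of "c ! k" "c ! (Suc k mod ?l)"] e[OF k(1)] k s cV by blast
  moreover have "c ! j = parent (c ! k)"
    using parent_edges_iff[of "c ! k" "c ! j"] e[OF j(1)] j k cV by (auto simp: insert_commute)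
  ultimately have "Suc k mod ?l = j" using nth_eq_iff_index_eq[OF d s j(1)] by simp
  then show False using k(1) l by (cases "Suc k = ?l") (auto simp: j_def split: if_splits)
qed

text \<open>The step of the connectivity proof below: a child of \<open>x\<close> can move toward
  the end of the order inside the tree neighborhood of \<open>x\<close>. The last two vertices are
  excluded because at most one vertex follows them.\<close>

lemma child_adjacent_to_later_tree_neighbor:
  assumes v: "v \<in> V" "pos v + 2 < length vs"
  shows "\<exists>z\<in>neighbors parent_edges (parent v). pos v < pos z \<and> {v, z} \<in> E"
proof -
  let ?x = "parent v"
  note p = parent_properties[OF v(1) pos_less_top]
  have x: "?x \<in> V" "pos v < pos ?x" "{v, ?x} \<in> E" using p v by auto
  have xt: "pos ?x \<le> top_pos v" using neighbor_pos_le_top x by blast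
  show ?thesis
  proof (cases "pos ?x < top_pos v")
    case True
    \<comment> \<open>The parent of \<open>?x\<close> serves as \<open>z\<close>: since
      \<open>v\<close> has a neighbor beyond \<open>?x\<close>, it is adjacent to that
      parent.\<close>
    then have l: "pos ?x < length vs - 1" using top_vertex(1)[OF v(1)] by linarith
    note q = parent_properties[OF x(1) pos_less_top[OF x(1) l]]
    have "{v, parent ?x} \<in> E" using q(4) x True by blast
    have "{?x, parent ?x} \<in> parent_edges" using parent_edges_iff x(1) q l by simp
    then have "parent ?x \<in> neighbors parent_edges ?x" by (simp add: neighbors_def insert_commute)
    then show ?thesis using \<open>{v, parent ?x} \<in> E\<close> q(2) x(2) by (meson less_trans)
  next
    case False
    \<comment> \<open>The second largest neighbor of \<open>v\<close> has the largest one as its parent.\<close>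
    let ?S = "{u \<in> neighbors E v. pos v < pos u \<and> pos u < top_pos v}"
    have "?S \<noteq> {}" using two v unfolding two_higher_neighbors_def by blast
    moreover have "finite ?S" using finite_neighbors by simp
    ultimately obtain z where z: "z \<in> ?S" "\<And>u. u \<in> ?S \<Longrightarrow> pos u \<le> pos z"
      using obtains_MAX[of ?S pos] by (metis (lifting) Max_ge finite_imageI imageI)
    have zE: "{v, z} \<in> E" "pos v < pos z" "pos z < top_pos v"
      using z(1) by (auto simp: neighbors_def insert_commute)
    have zV: "z \<in> V" using zE edge_in_V by blast
    have l: "pos z < length vs - 1" using zE(3) top_vertex(1)[OF v(1)] by linarith
    note q = parent_properties[OF zV pos_less_top[OF zV l]]
    have vp: "{v, parent z} \<in> E" using q(4) zE by blast
    then have "pos (parent z) \<le> top_pos v" using neighbor_pos_le_top by blast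
    \<comment> \<open>A parent of \<open>z\<close> before the last neighbor of \<open>v\<close>
      would lie in \<open>?S\<close> beyond its maximum \<open>z\<close>.\<close>
    moreover have "\<not> pos (parent z) < top_pos v"
      using z(2)[of "parent z"] vp q(2) zE by (auto simp: neighbors_def insert_commute)
    ultimately have "parent z = ?x" using pos_inj q(1) x(1) False xt by simp
    then have "{z, ?x} \<in> parent_edges" using parent_edges_iff[of z ?x] zV x(1) q(2) l by simp
    then show ?thesis using zE by (auto simp: neighbors_def)
  qed
qed

lemma tree_neighborhood_connected:
  assumes x: "x \<in> V"
  shows "connected_graph (neighbors parent_edges x) (induced_edges E (neighbors parent_edges x))"
proof -
  let ?N = "neighbors parent_edges x"
  let ?R = "{(a, b). {a, b} \<in> induced_edges E ?N}"
  have sym: "sym (?R\<^sup>*)" by (rule sym_rtrancl) (auto simp: sym_def insert_commute)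
  have NV: "y \<in> V" if "y \<in> ?N" for y
    using that parent_edges_subset edge_in_V by (auto simp: neighbors_def)
  \<comment> \<open>The common target of all walks. If \<open>x\<close> is the last vertex it has no
    parent; the vertex just before it is then a child of \<open>x\<close>, since parents are
    later.\<close>
  define r where "r = (if pos x < length vs - 1 then parent x else vs ! (length vs - 2))"
  have last: "pos x = length vs - 1" if "\<not> pos x < length vs - 1"
    using that pos_less[OF x] by linarith
  have r: "r \<in> ?N"
  proof (cases "pos x < length vs - 1")
    case True
    then show ?thesis
      using parent_properties[OF x pos_less_top[OF x True]] x parent_edges_iff[of x "parent x"]
      by (simp add: r_def neighbors_def insert_commute)
  next
    case False
    let ?y = "vs ! (length vs - 2)"
    have y: "?y \<in> V" "pos ?y = length vs - 2" using len by (auto simp: nth_in_V pos_nth)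
    have yl: "pos ?y < length vs - 1" using y len by simp
    note p = parent_properties[OF y(1) pos_less_top[OF y(1) yl]]
    have "pos (parent ?y) = length vs - 1" using p(2) pos_less[OF p(1)] y(2) by linarith
    then have "parent ?y = x" using pos_inj p(1) x last[OF False] by simp
    then show ?thesis
      using parent_edges_iff[of ?y x] y x yl last[OF False] False by (simp add: r_def neighbors_def)
  qed
  have "(y, r) \<in> ?R\<^sup>*" if "y \<in> ?N" for y
    using that
  proof (induction "length vs - pos y" arbitrary: y rule: less_induct)
    case less
    have yV: "y \<in> V" using NV less.prems .
    show ?case
    proof (cases "y = r")
      case False
      have "\<not> pos x \<le> pos y"
      proof
        assume le: "pos x \<le> pos y"
        then have "pos x < length vs - 1 \<and> y = parent x"
          using parent_edges_iff[of x y] less.prems x yV by (simp add: neighbors_def insert_commute)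
        then show False using False by (simp add: r_def)
      qed
      then have yx: "parent y = x" "pos y < pos x"
        using parent_edges_iff[of y x] less.prems x yV by (auto simp: neighbors_def)
      \<comment> \<open>A child at position \<open>length vs - 2\<close> has the last vertex as its
        parent and would be \<open>r\<close> itself.\<close>
      have "pos y + 2 < length vs"
      proof (rule ccontr)
        assume "\<not> pos y + 2 < length vs"
        then have "pos y = length vs - 2" "\<not> pos x < length vs - 1"
          using yx(2) pos_less[OF x] by linarith+
        then have "y = r" using nth_pos[OF yV] by (simp add: r_def)
        then show False using False by simp
      qed
      then obtain z where z: "z \<in> ?N" "pos y < pos z" "{y, z} \<in> E"
        using child_adjacent_to_later_tree_neighbor[OF yV] yx by auto
      have "(z, r) \<in> ?R\<^sup>*" using less.hyps[of z] z pos_less[OF NV[OF z(1)]] by simp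
      moreover have "(y, z) \<in> ?R" using z less.prems by (simp add: induced_edges_def)
      ultimately show ?thesis by (rule converse_rtrancl_into_rtrancl[rotated])
    qed simp
  qed
  then show ?thesis unfolding connected_graph_def using symD[OF sym] r by (blast intro: rtrancl_trans)
qed

lemma parent_edges_lcst: "locally_connected_spanning_tree V E parent_edges"
  unfolding locally_connected_spanning_tree_def spanning_tree_def
  using parent_edges_subset parent_edges_connected parent_edges_acyclic tree_neighborhood_connected
  by blast

end

section \<open>Necessity: deleting vertices in the given order\<close>

text \<open>The higher neighbors of a vertex form a clique, so deleting the vertices one by one in the
  given order does not destroy connectivity, even after the removal of \<open>x\<close>.\<close>

lemma suffix_connected:
  assumes "\<And>u w. u \<in> V - {x} \<Longrightarrow> w \<in> V - {x} \<Longrightarrow>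
      (u, w) \<in> {(a, b). {a, b} \<in> E \<and> a \<in> V - {x} \<and> b \<in> V - {x}}\<^sup>*"
    and "u \<in> set (drop i vs) - {x}" "w \<in> set (drop i vs) - {x}"
  shows "(u, w) \<in> {(a, b). {a, b} \<in> E \<and> a \<in> set (drop i vs) - {x} \<and> b \<in> set (drop i vs) - {x}}\<^sup>*"
  using assms(2,3)
proof (induction i arbitrary: u w)
  case 0
  then show ?case using assms(1) set_vs by simp
next
  case (Suc i)
  let ?R = "\<lambda>i. {(a, b). {a, b} \<in> E \<and> a \<in> set (drop i vs) - {x} \<and> b \<in> set (drop i vs) - {x}}"
  have sub: "set (drop (Suc i) vs) \<subseteq> set (drop i vs)" by (auto simp: in_drop_iff)
  have p: "(u, w) \<in> (?R i)\<^sup>*" using Suc sub by blast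
  \<comment> \<open>The second conjunct covers a walk standing on the vertex at position
    \<open>i\<close>, which the next suffix lacks: in its place, all its later neighbors other than
    \<open>x\<close> are reachable, so the walk can resume at any of them.\<close>
  have "(pos w \<noteq> i \<longrightarrow> (u, w) \<in> (?R (Suc i))\<^sup>*) \<and>
    (pos w = i \<longrightarrow> (\<forall>y \<in> neighbors E w - {x}. i < pos y \<longrightarrow> (u, y) \<in> (?R (Suc i))\<^sup>*))"
    using p
  proof (induction rule: rtrancl_induct)
    case base
    then show ?case using Suc.prems by (auto simp: in_drop_iff)
  next
    case (step y z)
    have e: "{y, z} \<in> E" "y \<in> V" "z \<in> V" "i \<le> pos y" "i \<le> pos z" "y \<noteq> x" "z \<noteq> x"
      using step.hyps(2) by (auto simp: in_drop_iff)
    have yz: "pos y \<noteq> pos z" using e edge_neq pos_inj by blast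
    show ?case
    proof (intro conjI impI ballI)
      assume z: "pos z \<noteq> i"
      show "(u, z) \<in> (?R (Suc i))\<^sup>*"
      proof (cases "pos y = i")
        case True
        then show ?thesis using step.IH e z by (auto simp: neighbors_def insert_commute)
      next
        case False
        then have "(y, z) \<in> ?R (Suc i)" using e z by (auto simp: in_drop_iff)
        then show ?thesis using step.IH False by (meson rtrancl.rtrancl_into_rtrancl)
      qed
    next
      fix y'
      assume z: "pos z = i" and y': "y' \<in> neighbors E z - {x}" "i < pos y'"
      have uy: "(u, y) \<in> (?R (Suc i))\<^sup>*" using step.IH yz z by auto
      show "(u, y') \<in> (?R (Suc i))\<^sup>*"
      proof (cases "y' = y")
        case False
        \<comment> \<open>The walk entered \<open>z\<close> from \<open>y\<close>, so
          \<open>y\<close> and \<open>y'\<close> are both later neighbors of \<open>z\<close>, and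
          the clique edge bypasses \<open>z\<close>.\<close>
        have "{y, y'} \<in> E"
          using higher_neighbors_clique[of z y y'] e y' z yz False
          by (auto simp: neighbors_def insert_commute)
        then have "(y, y') \<in> ?R (Suc i)" using e z yz y' edge_in_V by (auto simp: in_drop_iff)
        then show ?thesis using uy by (meson rtrancl.rtrancl_into_rtrancl)
      qed (use uy in simp)
    qed
  qed
  moreover have "pos w \<noteq> i" using Suc.prems by (auto simp: in_drop_iff)
  ultimately show ?case by blast
qed

text \<open>Deleting the last neighbor of \<open>v\<close> must leave \<open>v\<close> another later
  neighbor, which then lies strictly before the deleted one.\<close>

lemma lcst_imp_two_higher_neighbors:
  assumes T: "locally_connected_spanning_tree V E T" and len: "3 \<le> length vs"
  shows two_higher_neighbors
proof -
  \<comment> \<open>An isolated vertex of the suffix graph without \<open>x\<close> would be cut off from the vertex \<open>w\<close>.\<close>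
  have key: "\<exists>u\<in>neighbors E v. pos v < pos u \<and> u \<noteq> x"
    if v: "v \<in> V" and x: "x \<in> V" "x \<noteq> v" and w: "w \<in> V" "pos v < pos w" "w \<noteq> x" for v x w
  proof -
    let ?R = "{(a, b). {a, b} \<in> E \<and> a \<in> set (drop (pos v) vs) - {x} \<and> b \<in> set (drop (pos v) vs) - {x}}"
    have "(v, w) \<in> ?R\<^sup>*"
      by (rule suffix_connected[OF lcst_imp_vertex_deleted_connected[OF T graph x(1)]])
        (use v x w in \<open>auto simp: in_drop_iff\<close>)
    moreover have "v \<noteq> w" using w by auto
    ultimately obtain u where u: "(v, u) \<in> ?R" by (meson converse_rtranclE)
    then have "pos u \<noteq> pos v" using v pos_inj edge_neq[of v u] by (auto simp: in_drop_iff)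
    then show ?thesis using u by (auto simp: in_drop_iff neighbors_def insert_commute)
  qed
  have "\<exists>u\<in>neighbors E v. pos v < pos u \<and> pos u < top_pos v" if v: "v \<in> V" "pos v + 2 < length vs" for v
  proof -
    \<comment> \<open>If \<open>top_pos v = pos v\<close>, then \<open>v\<close> has no later
      neighbor, and the last vertex is a default for \<open>x\<close> that differs from
      \<open>v\<close>.\<close>
    define x where "x = (if top_pos v = pos v then vs ! (length vs - 1) else vs ! top_pos v)"
    have t: "top_pos v < length vs" "pos v \<le> top_pos v" using top_vertex(1) pos_le_top v by auto
    have xV: "x \<in> V" "x \<noteq> v" "pos x = (if top_pos v = pos v then length vs - 1 else top_pos v)"
      using t v nth_in_V pos_nth[of "length vs - 1"] pos_nth[of "top_pos v"] by (auto simp: x_def)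
    \<comment> \<open>One of the two vertices right after \<open>v\<close> differs from
      \<open>x\<close>; both exist because \<open>pos v + 2 < length vs\<close>.\<close>
    define w where "w = vs ! (if pos x = pos v + 1 then pos v + 2 else pos v + 1)"
    have w: "w \<in> V" "pos v < pos w" "w \<noteq> x"
      using v pos_nth[of "pos v + 1"] pos_nth[of "pos v + 2"] by (auto simp: w_def nth_in_V)
    obtain u where u: "u \<in> neighbors E v" "pos v < pos u" "u \<noteq> x" using key[OF v(1) xV(1,2) w] by auto
    have uE: "{v, u} \<in> E" using u(1) by (simp add: neighbors_def insert_commute)
    then have ut: "pos u \<le> top_pos v" "u \<in> V" using neighbor_pos_le_top edge_in_V by blast+
    then have "pos u \<noteq> top_pos v" using u xV pos_inj by (metis less_irrefl)
    then show ?thesis using u ut by auto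
  qed
  moreover have "top_pos (vs ! (length vs - 2)) = length vs - 1"
  proof -
    let ?v = "vs ! (length vs - 2)"
    have pv: "?v \<in> V" "pos ?v = length vs - 2" using len by (auto simp: nth_in_V pos_nth)
    \<comment> \<open>Here the first vertex is deleted. Among at least three vertices it is neither
      of the last two, so the second last vertex keeps a later neighbor, which can only be the
      last.\<close>
    have "0 < length vs" using len by linarith
    then have p0: "vs ! 0 \<in> V" "pos (vs ! 0) = 0" by (rule nth_in_V, rule pos_nth)
    have "length vs - 1 < length vs" using len by linarith
    then have pl: "vs ! (length vs - 1) \<in> V" "pos (vs ! (length vs - 1)) = length vs - 1"
      by (rule nth_in_V, rule pos_nth)
    have n1: "vs ! 0 \<noteq> ?v"
    proof
      assume "vs ! 0 = ?v"
      from arg_cong[OF this, of pos] show False unfolding p0(2) pv(2) using len by linarith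
    qed
    have n2: "vs ! (length vs - 1) \<noteq> vs ! 0"
    proof
      assume "vs ! (length vs - 1) = vs ! 0"
      from arg_cong[OF this, of pos] show False unfolding p0(2) pl(2) using len by linarith
    qed
    obtain u where u: "u \<in> neighbors E ?v" "pos ?v < pos u"
    proof -
      have "pos ?v < pos (vs ! (length vs - 1))" unfolding pv(2) pl(2) using len by linarith
      from key[OF pv(1) p0(1) n1 pl(1) this n2] that show thesis by blast
    qed
    have "pos u \<le> top_pos ?v" using neighbor_pos_le_top u(1) by (simp add: neighbors_def insert_commute)
    then show ?thesis using u(2) pv(2) top_vertex(1)[OF pv(1)] by linarith
  qed
  ultimately show ?thesis by (simp add: two_higher_neighbors_def)
qed

end

section \<open>Total correctness with time bounds\<close>

definition terminates :: "nat \<Rightarrow> com \<Rightarrow> nat \<Rightarrow> (state \<Rightarrow> bool) \<Rightarrow> state \<Rightarrow> bool" where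
  "terminates W c t Q s \<longleftrightarrow> (\<exists>t' s'. exec W c s t' s' \<and> t' \<le> t \<and> Q s')"

text \<open>Weakest precondition and cost bound of loop-free programs; the values for \<open>While\<close> are junk.\<close>

fun wp :: "nat \<Rightarrow> com \<Rightarrow> (state \<Rightarrow> bool) \<Rightarrow> state \<Rightarrow> bool" where
  "wp W Skip Q s = Q s"
| "wp W (Assign x e) Q s = (afits W e s \<and> Q (s\<lparr>reg := (reg s)(x := aval e s)\<rparr>))"
| "wp W (Store a i e) Q s = (afits W i s \<and> afits W e s \<and>
     Q (s\<lparr>arr := (arr s)(a := (arr s a)(aval i s := aval e s))\<rparr>))"
| "wp W (Seq c1 c2) Q s = wp W c1 (wp W c2 Q) s"
| "wp W (Cond b c1 c2) Q s = (bfits W b s \<and> (if bval b s then wp W c1 Q s else wp W c2 Q s))"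
| "wp W (While b c) Q s = False"

fun cost :: "com \<Rightarrow> nat" where
  "cost Skip = 1"
| "cost (Assign x e) = acost e + 1"
| "cost (Store a i e) = acost i + acost e + 1"
| "cost (Seq c1 c2) = cost c1 + cost c2"
| "cost (Cond b c1 c2) = bcost b + cost c1 + cost c2"
| "cost (While b c) = 0"

lemma wp_mono: "wp W c Q s \<Longrightarrow> (\<And>s'. Q s' \<Longrightarrow> Q' s') \<Longrightarrow> wp W c Q' s"
proof (induction c arbitrary: Q Q' s)
  case (Seq c1 c2)
  show ?case using Seq.prems by (auto intro: Seq.IH)
qed (auto split: if_splits)

lemma terminates_wp: "wp W c Q s \<Longrightarrow> terminates W c (cost c) Q s"
proof (induction c arbitrary: Q s)
  case (Seq c1 c2)
  then have "terminates W c1 (cost c1) (wp W c2 Q) s" by simp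
  then obtain t1 s1 where 1: "exec W c1 s t1 s1" "t1 \<le> cost c1" "wp W c2 Q s1"
    by (auto simp: terminates_def)
  then obtain t2 s2 where "exec W c2 s1 t2 s2" "t2 \<le> cost c2" "Q s2"
    using Seq.IH(2) by (fastforce simp: terminates_def)
  then show ?case using 1 exec.Seq by (fastforce simp: terminates_def)
next
  case (Cond b c1 c2)
  show ?case
  proof (cases "bval b s")
    case True
    then obtain t s' where "exec W c1 s t s'" "t \<le> cost c1" "Q s'"
      using Cond by (fastforce simp: terminates_def)
    then show ?thesis using True Cond.prems exec.CondTrue by (fastforce simp: terminates_def)
  next
    case False
    then obtain t s' where "exec W c2 s t s'" "t \<le> cost c2" "Q s'"
      using Cond by (fastforce simp: terminates_def)
    then show ?thesis using False Cond.prems exec.CondFalse by (fastforce simp: terminates_def)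
  qed
next
  case Skip
  then show ?case using exec.Skip by (fastforce simp: terminates_def)
next
  case Assign
  then show ?case using exec.Assign by (fastforce simp: terminates_def)
next
  case Store
  then show ?case using exec.Store by (fastforce simp: terminates_def)
qed simp

lemma terminates_mono: "terminates W c t Q s \<Longrightarrow> t \<le> t' \<Longrightarrow> terminates W c t' Q s"
  unfolding terminates_def by (meson le_trans)

lemma terminates_Seq:
  assumes "terminates W c1 t1 R s" "\<And>s1. R s1 \<Longrightarrow> terminates W c2 t2 Q s1"
  shows "terminates W (Seq c1 c2) (t1 + t2) Q s"
  using assms exec.Seq unfolding terminates_def by (meson add_mono)

text \<open>Each iteration lowers \<open>\<mu>\<close>, so there are at most \<open>\<mu> s\<close>
  of them, each paying for one test and one loop-free body; the extra \<open>bcost b\<close> pays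
  for the failing test.\<close>

lemma terminates_While:
  fixes \<mu> :: "state \<Rightarrow> nat"
  assumes body: "\<And>s. I s \<Longrightarrow> bval b s \<Longrightarrow> wp W c (\<lambda>s'. I s' \<and> \<mu> s' < \<mu> s) s"
    and fits: "\<And>s. I s \<Longrightarrow> bfits W b s"
    and post: "\<And>s. I s \<Longrightarrow> \<not> bval b s \<Longrightarrow> Q s"
    and init: "I s"
  shows "terminates W (While b c) (bcost b + \<mu> s * (bcost b + cost c)) Q s"
  using init
proof (induction "\<mu> s" arbitrary: s rule: less_induct)
  case less
  show ?case
  proof (cases "bval b s")
    case True
    obtain t1 s1 where 1: "exec W c s t1 s1" "t1 \<le> cost c" "I s1" "\<mu> s1 < \<mu> s"
      using terminates_wp[OF body[OF less.prems True]] by (auto simp: terminates_def)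
    then obtain t2 s2 where 2: "exec W (While b c) s1 t2 s2" "Q s2"
      "t2 \<le> bcost b + \<mu> s1 * (bcost b + cost c)"
      using less.hyps[OF 1(4,3)] by (auto simp: terminates_def)
    have "bcost b + t1 + t2 \<le> bcost b + Suc (\<mu> s1) * (bcost b + cost c)" using 1(2) 2(3) by simp
    also have "\<dots> \<le> bcost b + \<mu> s * (bcost b + cost c)"
      using 1(4) by (intro add_left_mono mult_right_mono) auto
    finally show ?thesis
      using exec.WhileTrue[OF fits[OF less.prems] True 1(1) 2(1)] 2(2) unfolding terminates_def by blast
  next
    case False
    then show ?thesis
      using exec.WhileFalse[OF fits[OF less.prems] False] post[OF less.prems False] le_add1
      unfolding terminates_def by blast
  qed
qed

section \<open>The program\<close>

text \<open>The arrays \<open>top\<close> and \<open>guide\<close> start from \<open>pos v\<close>,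
  the element that the maximum in \<open>top_pos\<close> and the minimum in \<open>guide\<close>
  always include.\<close>

definition index_arrays :: com where
  "index_arrays = Seq (Assign ''i'' (Const 0)) (While (Less (Reg ''i'') (Reg ''n''))
     (Seq (Store ''pos'' (Load ''order'' (Reg ''i'')) (Reg ''i''))
     (Seq (Store ''top'' (Load ''order'' (Reg ''i'')) (Reg ''i''))
     (Seq (Store ''guide'' (Load ''order'' (Reg ''i'')) (Reg ''i''))
          (Assign ''i'' (Plus (Reg ''i'') (Const 1)))))))"

text \<open>One flat loop replaces two nested ones: each iteration advances either \<open>e\<close>
  or \<open>v\<close>. This keeps the loop body within reach of \<open>wp\<close> and bounds the
  iterations by \<open>n\<close> plus the total length of the lists.\<close>

definition for_edges :: "com \<Rightarrow> com" where
  "for_edges c = Seq (Assign ''v'' (Const 0)) (Seq (Assign ''e'' (Const 0))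
     (While (Less (Reg ''v'') (Reg ''n''))
       (Cond (Less (Reg ''e'') (Load ''offset'' (Plus (Reg ''v'') (Const 1))))
         (Seq (Assign ''u'' (Load ''adj'' (Reg ''e'')))
           (Seq c (Assign ''e'' (Plus (Reg ''e'') (Const 1)))))
         (Assign ''v'' (Plus (Reg ''v'') (Const 1))))))"

definition update_top :: com where
  "update_top = Cond (Less (Load ''top'' (Reg ''v'')) (Load ''pos'' (Reg ''u'')))
     (Store ''top'' (Reg ''v'') (Load ''pos'' (Reg ''u''))) Skip"

text \<open>For an adjacent pair, \<open>v\<close> is a candidate for the guide of \<open>u\<close>,
  and \<open>u\<close> a candidate witness for two later neighbors of \<open>v\<close>. Both tests
  need the final values of \<open>top\<close>, hence a separate pass.\<close>

definition update_guide :: com where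
  "update_guide = Seq
     (Cond (And (Less (Load ''pos'' (Reg ''v'')) (Load ''guide'' (Reg ''u'')))
                (Less (Load ''pos'' (Reg ''u'')) (Load ''top'' (Reg ''v''))))
       (Store ''guide'' (Reg ''u'') (Load ''pos'' (Reg ''v''))) Skip)
     (Cond (And (Less (Load ''pos'' (Reg ''v'')) (Load ''pos'' (Reg ''u'')))
                (Less (Load ''pos'' (Reg ''u'')) (Load ''top'' (Reg ''v''))))
       (Store ''two'' (Reg ''v'') (Const 1)) Skip)"

text \<open>The nested loads follow the definition of \<open>parent\<close>. The edges are written
  in any case; \<open>answer\<close> tells whether they form a solution.\<close>

definition write_output :: com where
  "write_output = Seq (Seq (Assign ''i'' (Const 0)) (Assign ''answer'' (Const 1)))
    (Seq (While (Less (Plus (Reg ''i'') (Const 1)) (Reg ''n''))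
      (Seq (Store ''end1'' (Reg ''i'') (Load ''order'' (Reg ''i'')))
      (Seq (Store ''end2'' (Reg ''i'')
              (Load ''order'' (Load ''top'' (Load ''order''
                (Load ''guide'' (Load ''order'' (Reg ''i'')))))))
      (Seq (Cond (And (Less (Plus (Reg ''i'') (Const 2)) (Reg ''n''))
                      (Eq (Load ''two'' (Load ''order'' (Reg ''i''))) (Const 0)))
              (Assign ''answer'' (Const 0)) Skip)
           (Assign ''i'' (Plus (Reg ''i'') (Const 1)))))))
     (Cond (Less (Load ''top'' (Load ''order'' (Minus (Reg ''n'') (Const 2))))
                 (Minus (Reg ''n'') (Const 1)))
        (Assign ''answer'' (Const 0)) Skip))"

definition lcst_program :: com where
  "lcst_program = Seq index_arrays
     (Seq (for_edges update_top) (Seq (for_edges update_guide) write_output))"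

text \<open>Double counting: the entries correspond to ordered adjacent pairs, and each edge has at
  most two orientations.\<close>

lemma length_concat_adjacency_lists:
  assumes "adjacency_lists n E adj" "simple_graph {..<n} E"
  shows "length (concat adj) \<le> 2 * card E"
proof -
  have len: "length adj = n" using assms by (simp add: adjacency_lists_def)
  have finE: "finite E"
    by (rule finite_subset[of _ "Pow {..<n}"]) (use assms in \<open>auto simp: simple_graph_def\<close>)
  have fin: "finite (neighbors E v)" for v
    by (rule finite_subset[of _ "{..<n}"]) (use assms in \<open>auto simp: simple_graph_def neighbors_def\<close>)
  have "length (concat adj) = (\<Sum>v<n. length (adj ! v))"
    by (simp add: length_concat sum_list_sum_nth len atLeast0LessThan)
  also have "\<dots> = (\<Sum>v<n. card (neighbors E v))"
    using assms by (intro sum.cong) (auto simp: adjacency_lists_def distinct_card[symmetric])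
  also have "\<dots> = card (SIGMA v:{..<n}. neighbors E v)" using fin by simp
  also have "\<dots> \<le> card (\<Union>e\<in>E. {(v, u). {u, v} = e})"
  proof (rule card_mono)
    have "(\<Union>e\<in>E. {(v, u). {u, v} = e}) \<subseteq> {..<n} \<times> {..<n}"
      using assms by (auto simp: simple_graph_def)
    then show "finite (\<Union>e\<in>E. {(v, u). {u, v} = e})" by (rule finite_subset) simp
  qed (auto simp: neighbors_def)
  also have "\<dots> \<le> (\<Sum>e\<in>E. card {(v, u). {u, v} = e})" by (rule card_UN_le[OF finE])
  also have "\<dots> \<le> (\<Sum>e\<in>E. 2)"
  proof (rule sum_mono)
    fix e assume "e \<in> E"
    then have "card e = 2" using assms by (simp add: simple_graph_def)
    then obtain a b where ab: "e = {a, b}" by (auto simp: card_2_iff)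
    have "{(v, u). {u, v} = e} \<subseteq> {(a, b), (b, a)}" by (auto simp: ab doubleton_eq_iff)
    then have "card {(v, u). {u, v} = e} \<le> card {(a, b), (b, a)}" by (rule card_mono[rotated]) simp
    also have "\<dots> \<le> 2" by (cases "a = b") simp_all
    finally show "card {(v, u). {u, v} = e} \<le> 2" .
  qed
  finally show ?thesis by simp
qed

section \<open>Correctness and running time\<close>

text \<open>The bound on \<open>W\<close> leaves room for vertices, positions, offsets and the small
  constants and increments of the program.\<close>

locale lcst_input = strong_elimination "{..<n}" E vs pos
  for n :: nat and E :: "nat set set" and vs :: "nat list" and pos :: "nat \<Rightarrow> nat" +
  fixes adj :: "nat list list" and W :: nat
  assumes n: "3 \<le> n" and adj: "adjacency_lists n E adj" and W: "n + length (concat adj) + 3 \<le> W"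
begin

section \<open>Memory layout and the sweep over all adjacent pairs\<close>

definition off :: "nat \<Rightarrow> nat" where
  "off v = length (concat (take v adj))"

definition loaded :: "(string \<Rightarrow> nat \<Rightarrow> nat) \<Rightarrow> bool" where
  "loaded A \<longleftrightarrow> (\<forall>v\<le>n. A ''offset'' v = off v) \<and>
     (\<forall>v<n. \<forall>k<length (adj ! v). A ''adj'' (off v + k) = adj ! v ! k) \<and>
     (\<forall>i<n. A ''order'' i = vs ! i)"

lemma length_vs: "length vs = n"
  using distinct_card[OF distinct_vs] set_vs by simp

lemma length_adj: "length adj = n"
  using adj by (simp add: adjacency_lists_def)

lemma set_adj: "v < n \<Longrightarrow> set (adj ! v) = neighbors E v"
  using adj by (simp add: adjacency_lists_def)

lemma set_adj_less: "v < n \<Longrightarrow> u \<in> set (adj ! v) \<Longrightarrow> u < n"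
  using set_adj edge_in_V by (auto simp: neighbors_def)

lemma vs_less: "i < n \<Longrightarrow> vs ! i < n"
  using nth_in_V length_vs by simp

lemma pos_less_n: "v < n \<Longrightarrow> pos v < n"
  using pos_less length_vs by simp

lemma off_Suc: "v < n \<Longrightarrow> off (Suc v) = off v + length (adj ! v)"
  by (simp add: off_def take_Suc_conv_app_nth length_adj)

lemma off_n: "off n = length (concat adj)"
  by (simp add: off_def length_adj)

lemma off_mono: "v \<le> w \<Longrightarrow> w \<le> n \<Longrightarrow> off v \<le> off w"
proof (induction w rule: dec_induct)
  case (step w)
  then show ?case using off_Suc[of w] by simp
qed simp

lemma concat_adj_nth:
  assumes "v < n" "k < length (adj ! v)"
  shows "concat adj ! (off v + k) = adj ! v ! k"
proof -
  have "concat adj = concat (take v adj) @ adj ! v @ concat (drop (Suc v) adj)"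
    using id_take_nth_drop[of v adj] assms(1) length_adj by (metis concat.simps(2) concat_append)
  then show ?thesis using assms(2) by (simp add: off_def nth_append)
qed

lemma loaded_input: "loaded (arr (input_state n m adj vs))"
proof -
  have "off v + k < length (concat adj)" if "v < n" "k < length (adj ! v)" for v k
    using off_mono[of "Suc v" n] off_Suc off_n that by simp
  then show ?thesis
    using concat_adj_nth length_vs unfolding loaded_def input_state_def array_of_def
    by (simp add: off_def[symmetric] del: upt_Suc)
qed

text \<open>The pairs already handled when the sweep stands at entry \<open>k\<close> of the list of
  \<open>v\<close>, that is, when \<open>e\<close> equals \<open>off v + k\<close>.\<close>

definition visited :: "nat \<Rightarrow> nat \<Rightarrow> (nat \<times> nat) set" where
  "visited v k = {(w, u). w < v \<and> u \<in> set (adj ! w)} \<union> {v} \<times> set (take k (adj ! v))"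

definition edge_pairs :: "(nat \<times> nat) set" where
  "edge_pairs = {(v, u). v < n \<and> u \<in> set (adj ! v)}"

lemma visited_0: "visited 0 0 = {}" and visited_n: "visited n 0 = edge_pairs"
  by (auto simp: visited_def edge_pairs_def)

lemma visited_Suc: "visited (Suc v) 0 = visited v (length (adj ! v))"
  by (auto simp: visited_def less_Suc_eq)

lemma visited_insert: "k < length (adj ! v) \<Longrightarrow> visited v (Suc k) = insert (v, adj ! v ! k) (visited v k)"
  by (auto simp: visited_def take_Suc_conv_app_nth)

lemma visited_subset: "v < n \<Longrightarrow> visited v k \<subseteq> edge_pairs"
  by (auto simp: visited_def edge_pairs_def dest: in_set_takeD)

lemma finite_edge_pairs: "finite edge_pairs"
  by (rule finite_subset[of _ "{..<n} \<times> {..<n}"]) (auto simp: edge_pairs_def dest: set_adj_less)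

text \<open>Stating the invariant over the set \<open>D\<close> of handled pairs hides offsets and
  list order from the body. The body must preserve the registers, which hold the loop state. The
  summand 20 pays for the tests, the fetch and the counter updates of an iteration.\<close>

lemma for_edges:
  assumes body: "\<And>D s. I D (arr s) \<Longrightarrow> D \<subseteq> edge_pairs \<Longrightarrow> reg s ''n'' = n \<Longrightarrow>
      reg s ''v'' < n \<Longrightarrow> reg s ''u'' \<in> set (adj ! reg s ''v'') \<Longrightarrow>
      wp W c (\<lambda>s'. I (insert (reg s ''v'', reg s ''u'') D) (arr s') \<and> reg s' = reg s) s"
    and loaded: "\<And>D A. I D A \<Longrightarrow> loaded A"
    and init: "I {} (arr s)" "reg s ''n'' = n"
  shows "terminates W (for_edges c) (7 + (n + length (concat adj)) * (cost c + 20))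
    (\<lambda>s'. I edge_pairs (arr s') \<and> reg s' ''n'' = n) s"
proof -
  \<comment> \<open>\<open>k\<close> is the index inside the list of \<open>v\<close>. At the end
    \<open>v = n\<close>, where no list exists and \<open>k\<close> is 0.\<close>
  let ?inv = "\<lambda>s :: state. reg s ''n'' = n \<and> (\<exists>k. reg s ''e'' = off (reg s ''v'') + k \<and>
    (reg s ''v'' < n \<and> k \<le> length (adj ! reg s ''v'') \<or> reg s ''v'' = n \<and> k = 0) \<and>
    I (visited (reg s ''v'') k) (arr s))"
  let ?b = "Less (Reg ''v'') (Reg ''n'')"
  let ?c = "Cond (Less (Reg ''e'') (Load ''offset'' (Plus (Reg ''v'') (Const 1))))
         (Seq (Assign ''u'' (Load ''adj'' (Reg ''e'')))
           (Seq c (Assign ''e'' (Plus (Reg ''e'') (Const 1)))))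
         (Assign ''v'' (Plus (Reg ''v'') (Const 1)))"
  \<comment> \<open>Every iteration advances exactly one of \<open>v\<close> and \<open>e\<close>,
    which never pass \<open>n\<close> and \<open>off n\<close>.\<close>
  let ?\<mu> = "\<lambda>s :: state. (n - reg s ''v'') + (off n - reg s ''e'')"
  let ?Q = "\<lambda>s' :: state. I edge_pairs (arr s') \<and> reg s' ''n'' = n"
  have loop: "terminates W (While ?b ?c) (bcost ?b + ?\<mu> s * (bcost ?b + cost ?c)) ?Q s" if "?inv s" for s :: state
  proof (rule terminates_While[where I = ?inv])
    fix s :: state assume inv: "?inv s" and "bval ?b s"
    then have v: "reg s ''v'' < n" by simp
    obtain k where k: "reg s ''e'' = off (reg s ''v'') + k" "k \<le> length (adj ! reg s ''v'')"
      "I (visited (reg s ''v'') k) (arr s)" using inv v by auto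
    have ld: "loaded (arr s)" using loaded k by blast
    have oS: "off (Suc (reg s ''v'')) = off (reg s ''v'') + length (adj ! reg s ''v'')"
      using off_Suc v by simp
    have le: "off (Suc (reg s ''v'')) \<le> off n" using off_mono v by simp
    have offs: "arr s ''offset'' (Suc (reg s ''v'')) = off (Suc (reg s ''v''))"
      using ld v by (simp add: loaded_def)
    have bnd: "off n + n + 3 \<le> W" using W off_n by simp
    show "wp W ?c (\<lambda>s'. ?inv s' \<and> ?\<mu> s' < ?\<mu> s) s"
    proof (cases "k < length (adj ! reg s ''v'')")
      case True
      let ?u = "adj ! reg s ''v'' ! k"
      let ?s = "s\<lparr>reg := (reg s)(''u'' := ?u)\<rparr>"
      have u: "arr s ''adj'' (reg s ''e'') = ?u" using ld v True k(1) by (simp add: loaded_def)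
      have uS: "?u \<in> set (adj ! reg s ''v'')" using True by simp
      have "wp W c (\<lambda>s'. I (insert (reg ?s ''v'', reg ?s ''u'') (visited (reg s ''v'') k)) (arr s') \<and>
          reg s' = reg ?s) ?s"
        by (rule body) (use k(3) visited_subset v uS inv in simp_all)
      then have "wp W (Seq c (Assign ''e'' (Plus (Reg ''e'') (Const 1)))) (\<lambda>s'. ?inv s' \<and> ?\<mu> s' < ?\<mu> s) ?s"
        unfolding wp.simps
      proof (rule wp_mono, goal_cases)
        case (1 s')
        then have "reg s' ''v'' = reg s ''v''" "reg s' ''e'' = reg s ''e''" "reg s' ''n'' = n"
          "I (visited (reg s ''v'') (Suc k)) (arr s')"
          using inv visited_insert[OF True] by auto
        moreover have "reg s ''e'' < off n" using k(1) True oS le by simp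
        ultimately show ?case using v k(1) True bnd by auto
      qed
      moreover have "?u \<le> W" using set_adj_less[OF v uS] bnd by simp
      moreover have "reg s ''e'' < off (Suc (reg s ''v''))" using k(1) True oS by simp
      ultimately show ?thesis using u offs le v bnd by simp
    next
      case False
      then have kl: "k = length (adj ! reg s ''v'')" using k(2) by simp
      have "I (visited (Suc (reg s ''v'')) 0) (arr s)" using k(3) kl visited_Suc by simp
      then show ?thesis using kl k(1) offs oS le v bnd inv by auto
    qed
  next
    fix s :: state assume "?inv s"
    then show "bfits W ?b s" using W by auto
  next
    fix s :: state assume "?inv s" "\<not> bval ?b s"
    then show "?Q s" unfolding visited_n[symmetric] by auto
  qed (use that in simp)
  have "terminates W (for_edges c) (2 + (2 + (bcost ?b + (n + off n) * (bcost ?b + cost ?c)))) ?Q s"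
    unfolding for_edges_def
  proof (rule terminates_Seq[where R = "\<lambda>s. I {} (arr s) \<and> reg s ''n'' = n \<and> reg s ''v'' = 0"])
    show "terminates W (Assign ''v'' (Const 0)) 2 (\<lambda>s. I {} (arr s) \<and> reg s ''n'' = n \<and> reg s ''v'' = 0) s"
      using terminates_wp[of W "Assign ''v'' (Const 0)"] init by (simp add: numeral_2_eq_2)
  next
    fix s1 :: state assume s1: "I {} (arr s1) \<and> reg s1 ''n'' = n \<and> reg s1 ''v'' = 0"
    show "terminates W (Seq (Assign ''e'' (Const 0)) (While ?b ?c))
        (2 + (bcost ?b + (n + off n) * (bcost ?b + cost ?c))) ?Q s1"
    proof (rule terminates_Seq[where R = "\<lambda>s. I {} (arr s) \<and> reg s ''n'' = n \<and> reg s ''v'' = 0 \<and> reg s ''e'' = 0"])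
      show "terminates W (Assign ''e'' (Const 0)) 2
        (\<lambda>s. I {} (arr s) \<and> reg s ''n'' = n \<and> reg s ''v'' = 0 \<and> reg s ''e'' = 0) s1"
        using terminates_wp[of W "Assign ''e'' (Const 0)"] s1 by (simp add: numeral_2_eq_2)
    next
      fix s2 :: state
      assume s2: "I {} (arr s2) \<and> reg s2 ''n'' = n \<and> reg s2 ''v'' = 0 \<and> reg s2 ''e'' = 0"
      then have "?inv s2" using n by (auto simp: off_def visited_0)
      from loop[OF this] s2 show "terminates W (While ?b ?c)
          (bcost ?b + (n + off n) * (bcost ?b + cost ?c)) ?Q s2" by simp
    qed
  qed
  then show ?thesis by (rule terminates_mono) (simp add: off_n algebra_simps)
qed

section \<open>Invariants and correctness of the passes\<close>

definition positions :: "(string \<Rightarrow> nat \<Rightarrow> nat) \<Rightarrow> bool" where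
  "positions A \<longleftrightarrow> loaded A \<and> (\<forall>v<n. A ''pos'' v = pos v)"

text \<open>The initial values of \<open>guide\<close> and \<open>two\<close> are carried along
  because the second pass starts from them.\<close>

definition top_inv :: "(nat \<times> nat) set \<Rightarrow> (string \<Rightarrow> nat \<Rightarrow> nat) \<Rightarrow> bool" where
  "top_inv D A \<longleftrightarrow> positions A \<and> (\<forall>v<n. A ''guide'' v = pos v \<and> A ''two'' v = 0 \<and>
     A ''top'' v = Max (insert (pos v) (pos ` {u. (v, u) \<in> D})))"

definition guide_inv :: "(nat \<times> nat) set \<Rightarrow> (string \<Rightarrow> nat \<Rightarrow> nat) \<Rightarrow> bool" where
  "guide_inv D A \<longleftrightarrow> positions A \<and> (\<forall>v<n. A ''top'' v = top_pos v \<and>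
     A ''guide'' v = Min (insert (pos v) {pos w | w. (w, v) \<in> D \<and> pos v < top_pos w}) \<and>
     A ''two'' v = of_bool (\<exists>u. (v, u) \<in> D \<and> pos v < pos u \<and> pos u < top_pos v))"

lemma loaded_update:
  "a \<noteq> ''offset'' \<Longrightarrow> a \<noteq> ''adj'' \<Longrightarrow> a \<noteq> ''order'' \<Longrightarrow> loaded (A(a := f)) \<longleftrightarrow> loaded A"
  by (simp add: loaded_def)

lemma index_arrays:
  assumes init: "loaded (arr s)" "reg s ''n'' = n" "\<And>v. arr s ''two'' v = 0"
  shows "terminates W index_arrays (5 + n * 22)
    (\<lambda>s'. top_inv {} (arr s') \<and> reg s' ''n'' = n) s"
proof -
  let ?inv = "\<lambda>s :: state. loaded (arr s) \<and> reg s ''n'' = n \<and> reg s ''i'' \<le> n \<and> (\<forall>v. arr s ''two'' v = 0) \<and>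
    (\<forall>j<reg s ''i''. arr s ''pos'' (vs ! j) = j \<and> arr s ''top'' (vs ! j) = j \<and> arr s ''guide'' (vs ! j) = j)"
  let ?b = "Less (Reg ''i'') (Reg ''n'')"
  let ?c = "(Seq (Store ''pos'' (Load ''order'' (Reg ''i'')) (Reg ''i''))
     (Seq (Store ''top'' (Load ''order'' (Reg ''i'')) (Reg ''i''))
     (Seq (Store ''guide'' (Load ''order'' (Reg ''i'')) (Reg ''i''))
          (Assign ''i'' (Plus (Reg ''i'') (Const 1))))))"
  let ?\<mu> = "\<lambda>s :: state. n - reg s ''i''"
  let ?Q = "\<lambda>s' :: state. top_inv {} (arr s') \<and> reg s' ''n'' = n"
  have loop: "terminates W (While ?b ?c) (bcost ?b + ?\<mu> s * (bcost ?b + cost ?c)) ?Q s"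
    if "?inv s" for s :: state
  proof (rule terminates_While[where I = ?inv])
    fix s :: state assume inv: "?inv s" and "bval ?b s"
    then have i: "reg s ''i'' < n" by simp
    have o: "arr s ''order'' (reg s ''i'') = vs ! reg s ''i''" using inv i by (simp add: loaded_def)
    \<comment> \<open>By distinctness, the stores for the current position leave the entries of
      earlier positions intact.\<close>
    have "vs ! j \<noteq> vs ! reg s ''i''" if "j < reg s ''i''" for j
      using that i distinct_vs length_vs by (simp add: nth_eq_iff_index_eq)
    then show "wp W ?c (\<lambda>s'. ?inv s' \<and> ?\<mu> s' < ?\<mu> s) s"
      using inv i o W vs_less[OF i] by (auto simp: loaded_update less_Suc_eq)
  next
    fix s :: state assume "?inv s"
    then show "bfits W ?b s" using W by auto
  next
    fix s :: state assume inv: "?inv s" and "\<not> bval ?b s"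
    then have i: "reg s ''i'' = n" by simp
    have "arr s ''pos'' v = pos v \<and> arr s ''top'' v = pos v \<and> arr s ''guide'' v = pos v" if "v < n" for v
      using inv pos_less_n[OF that] nth_pos[of v] that unfolding i by (metis lessThan_iff)
    then show "?Q s" using inv by (simp add: top_inv_def positions_def)
  qed (use that in simp)
  have "terminates W index_arrays (2 + (bcost ?b + n * (bcost ?b + cost ?c))) ?Q s"
    unfolding index_arrays_def
  proof (rule terminates_Seq[where R = "\<lambda>s. ?inv s \<and> reg s ''i'' = 0"])
    show "terminates W (Assign ''i'' (Const 0)) 2 (\<lambda>s. ?inv s \<and> reg s ''i'' = 0) s"
      using terminates_wp[of W "Assign ''i'' (Const 0)"] init by (simp add: numeral_2_eq_2)
  next
    fix s1 :: state assume s1: "?inv s1 \<and> reg s1 ''i'' = 0"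
    then show "terminates W (While ?b ?c) (bcost ?b + n * (bcost ?b + cost ?c)) ?Q s1"
      using loop[of s1] by simp
  qed
  then show ?thesis by (rule terminates_mono) simp
qed

lemma for_edges_update_top:
  assumes "top_inv {} (arr s)" "reg s ''n'' = n"
  shows "terminates W (for_edges update_top) (7 + (n + length (concat adj)) * 30)
    (\<lambda>s'. guide_inv {} (arr s') \<and> reg s' ''n'' = n) s"
proof -
  have "terminates W (for_edges update_top) (7 + (n + length (concat adj)) * (cost update_top + 20))
    (\<lambda>s'. top_inv edge_pairs (arr s') \<and> reg s' ''n'' = n) s"
  proof (rule for_edges[where I = top_inv, OF _ _ assms])
    fix D and s :: state
    assume inv: "top_inv D (arr s)" and D: "D \<subseteq> edge_pairs"
      and v: "reg s ''v'' < n" and u: "reg s ''u'' \<in> set (adj ! reg s ''v'')"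
    let ?v = "reg s ''v''" and ?u = "reg s ''u''"
    have u': "?u < n" using set_adj_less v u .
    have fin: "finite D" using D finite_edge_pairs by (rule finite_subset)
    have finD: "finite {u. (w, u) \<in> D}" for w
      using finite_imageI[OF fin, of snd] by (rule finite_subset[rotated]) force
    have t: "arr s ''top'' ?v = Max (insert (pos ?v) (pos ` {u. (?v, u) \<in> D}))"
      using inv v by (simp add: top_inv_def)
    \<comment> \<open>The maximum is attained, so it is a position below \<open>n\<close>; this
      makes reading it fit the word bound.\<close>
    have "arr s ''top'' ?v \<in> insert (pos ?v) (pos ` {u. (?v, u) \<in> D})"
      unfolding t using finD by (intro Max_in) auto
    then have tn: "arr s ''top'' ?v < n"
      using D v set_adj_less pos_less_n by (auto simp: edge_pairs_def)
    have "{u. (w, u) \<in> insert (?v, ?u) D} = (if w = ?v then insert ?u {u. (w, u) \<in> D} else {u. (w, u) \<in> D})" for w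
      by auto
    moreover have "Max (insert (pos ?v) (insert (pos ?u) (pos ` {u. (?v, u) \<in> D}))) = max (pos ?u) (arr s ''top'' ?v)"
      unfolding t insert_commute[of "pos ?v"] using finD by (subst Max_insert) auto
    ultimately show "wp W update_top (\<lambda>s'. top_inv (insert (?v, ?u) D) (arr s') \<and> reg s' = reg s) s"
      using inv v u' tn pos_less_n[OF u'] W
      by (auto simp: update_top_def top_inv_def positions_def loaded_update)
  qed (simp add: top_inv_def positions_def)
  \<comment> \<open>Once all pairs are handled, those starting at \<open>v\<close> give exactly the
    neighbors of \<open>v\<close>, so the maximum is \<open>top_pos v\<close>. The initial
    \<open>guide\<close> and \<open>two\<close> are the values for an empty set of pairs.\<close>
  moreover have "guide_inv {} A" if "top_inv edge_pairs A" for A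
    using that by (simp add: top_inv_def guide_inv_def top_pos_def edge_pairs_def set_adj)
  ultimately show ?thesis by (auto simp: terminates_def update_top_def)
qed

lemma for_edges_update_guide:
  assumes "guide_inv {} (arr s)" "reg s ''n'' = n"
  shows "terminates W (for_edges update_guide) (7 + (n + length (concat adj)) * 60)
    (\<lambda>s'. guide_inv edge_pairs (arr s') \<and> reg s' ''n'' = n) s"
proof -
  have "terminates W (for_edges update_guide) (7 + (n + length (concat adj)) * (cost update_guide + 20))
    (\<lambda>s'. guide_inv edge_pairs (arr s') \<and> reg s' ''n'' = n) s"
  proof (rule for_edges[where I = guide_inv, OF _ _ assms])
    fix D and s :: state
    assume inv: "guide_inv D (arr s)" and D: "D \<subseteq> edge_pairs"
      and v: "reg s ''v'' < n" and u: "reg s ''u'' \<in> set (adj ! reg s ''v'')"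
    let ?v = "reg s ''v''" and ?u = "reg s ''u''"
    let ?C = "\<lambda>D u. {pos w | w. (w, u) \<in> D \<and> pos u < top_pos w}"
    have u': "?u < n" using set_adj_less v u .
    have fin: "finite D" using D finite_edge_pairs by (rule finite_subset)
    have finC: "finite (?C D w)" for w
      using finite_imageI[OF fin, of "pos \<circ> fst"] by (rule finite_subset[rotated]) force
    have g: "arr s ''guide'' ?u = Min (insert (pos ?u) (?C D ?u))"
      using inv u' by (simp add: guide_inv_def)
    have gn: "arr s ''guide'' ?u \<le> pos ?u" unfolding g using finC by (intro Min_le) auto
    have p: "arr s ''pos'' ?u = pos ?u" "arr s ''pos'' ?v = pos ?v" "arr s ''top'' ?v = top_pos ?v"
      using inv u' v by (auto simp: guide_inv_def positions_def)
    have b: "pos ?u < n" "pos ?v < n" "top_pos ?v < n"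
      using pos_less_n u' v top_vertex(1)[of ?v] length_vs by auto
    \<comment> \<open>The new pair adds a candidate only for \<open>?u\<close>, and only if the last
      neighbor of \<open>?v\<close> lies beyond \<open>?u\<close>.\<close>
    have C: "?C (insert (?v, ?u) D) w =
        (if w = ?u \<and> pos ?u < top_pos ?v then insert (pos ?v) (?C D w) else ?C D w)" for w
      by auto
    have M: "Min (insert (pos ?u) (insert (pos ?v) (?C D ?u))) = min (pos ?v) (arr s ''guide'' ?u)"
      unfolding g insert_commute[of "pos ?u"] using finC by (subst Min_insert) auto
    have X: "(\<exists>u. (w, u) \<in> insert (?v, ?u) D \<and> pos w < pos u \<and> pos u < top_pos w) \<longleftrightarrow>
        (w = ?v \<and> pos ?v < pos ?u \<and> pos ?u < top_pos ?v) \<or>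
        (\<exists>u. (w, u) \<in> D \<and> pos w < pos u \<and> pos u < top_pos w)" for w
      by auto
    show "wp W update_guide (\<lambda>s'. guide_inv (insert (?v, ?u) D) (arr s') \<and> reg s' = reg s) s"
      unfolding guide_inv_def C X
      using inv v u' gn b p W M
      by (auto simp: update_guide_def guide_inv_def positions_def loaded_update)
  qed (simp add: guide_inv_def positions_def)
  then show ?thesis by (rule terminates_mono) (simp add: update_guide_def)
qed

lemma guide_inv_update:
  "guide_inv D (A(''end1'' := f)) \<longleftrightarrow> guide_inv D A" "guide_inv D (A(''end2'' := f)) \<longleftrightarrow> guide_inv D A"
  by (simp_all add: guide_inv_def positions_def loaded_update)

lemma write_output:
  assumes init: "guide_inv edge_pairs (arr s)" "reg s ''n'' = n"
  shows "terminates W write_output (30 + n * 50)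
    (\<lambda>s'. reg s' ''answer'' = of_bool two_higher_neighbors \<and> output_edges n s' = parent_edges) s"
proof -
  let ?two = "\<lambda>j. \<exists>u\<in>neighbors E (vs ! j). j < pos u \<and> pos u < top_pos (vs ! j)"
  let ?inv = "\<lambda>s :: state. guide_inv edge_pairs (arr s) \<and> reg s ''n'' = n \<and> reg s ''i'' < n \<and>
    (\<forall>j<reg s ''i''. arr s ''end1'' j = vs ! j \<and> arr s ''end2'' j = parent (vs ! j)) \<and>
    reg s ''answer'' = of_bool (\<forall>j<reg s ''i''. j + 2 < n \<longrightarrow> ?two j)"
  let ?b = "Less (Plus (Reg ''i'') (Const 1)) (Reg ''n'')"
  let ?c = "(Seq (Store ''end1'' (Reg ''i'') (Load ''order'' (Reg ''i'')))
      (Seq (Store ''end2'' (Reg ''i'')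
              (Load ''order'' (Load ''top'' (Load ''order''
                (Load ''guide'' (Load ''order'' (Reg ''i'')))))))
      (Seq (Cond (And (Less (Plus (Reg ''i'') (Const 2)) (Reg ''n''))
                      (Eq (Load ''two'' (Load ''order'' (Reg ''i''))) (Const 0)))
              (Assign ''answer'' (Const 0)) Skip)
           (Assign ''i'' (Plus (Reg ''i'') (Const 1))))))"
  let ?d = "Cond (Less (Load ''top'' (Load ''order'' (Minus (Reg ''n'') (Const 2))))
                 (Minus (Reg ''n'') (Const 1)))
        (Assign ''answer'' (Const 0)) Skip"
  let ?\<mu> = "\<lambda>s :: state. n - reg s ''i''"
  let ?Q = "\<lambda>s' :: state. reg s' ''answer'' = of_bool two_higher_neighbors \<and> output_edges n s' = parent_edges"
  have arrays: "A ''order'' i = vs ! i" "A ''guide'' (vs ! i) = guide (vs ! i)"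
    "A ''top'' (vs ! i) = top_pos (vs ! i)" "A ''two'' (vs ! i) = of_bool (?two i)"
    if "guide_inv edge_pairs A" "i < n" for A i
  proof -
    \<comment> \<open>The pass collects candidates \<open>w\<close> from pairs
      \<open>(w, v)\<close>, whereas \<open>guide\<close> ranges over the neighbors of
      \<open>v\<close>; symmetry of adjacency identifies the two.\<close>
    have "w \<in> neighbors E v \<longleftrightarrow> v \<in> neighbors E w" for v w by (simp add: neighbors_def insert_commute)
    moreover have "(w, v) \<in> edge_pairs \<longleftrightarrow> v \<in> neighbors E w" for w v
      using set_adj[of w] edge_in_V[of w v] by (auto simp: edge_pairs_def neighbors_def insert_commute)
    ultimately show "A ''order'' i = vs ! i" "A ''guide'' (vs ! i) = guide (vs ! i)"
      "A ''top'' (vs ! i) = top_pos (vs ! i)" "A ''two'' (vs ! i) = of_bool (?two i)"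
      using that vs_less[OF that(2)] pos_nth[of i] length_vs
      unfolding guide_inv_def positions_def loaded_def guide_def by (auto simp: Bex_def)
  qed
  have bounds: "guide (vs ! i) < n" "top_pos (vs ! i) < n" if "i < n" for i
    using guide_properties(1)[of "vs ! i"] pos_less_n[of "vs ! i"] top_vertex(1)[of "vs ! i"]
      vs_less[OF that] length_vs by auto
  have loop: "terminates W (While ?b ?c) (bcost ?b + ?\<mu> s * (bcost ?b + cost ?c))
      (\<lambda>s. ?inv s \<and> reg s ''i'' = n - 1) s"
    if "?inv s" for s :: state
  proof (rule terminates_While[where I = ?inv])
    fix s :: state assume inv: "?inv s" and "bval ?b s"
    then have i: "reg s ''i'' < n" "Suc (reg s ''i'') < n" by auto
    note gi = conjunct1[OF inv]
    define g where "g = guide (vs ! reg s ''i'')"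
    define t where "t = top_pos (vs ! g)"
    have lt: "g < n" "t < n" using bounds i unfolding g_def t_def by auto
    have p: "parent (vs ! reg s ''i'') = vs ! t" by (simp add: parent_def g_def t_def)
    have less: "vs ! t < n" "vs ! g < n" "vs ! reg s ''i'' < n" using vs_less lt i by auto
    note a = arrays[OF gi i(1), folded g_def] arrays(1,3)[OF gi lt(1), folded t_def] arrays(1)[OF gi lt(2)]
    show "wp W ?c (\<lambda>s'. ?inv s' \<and> ?\<mu> s' < ?\<mu> s) s"
      using inv i a lt less W p by (auto simp: guide_inv_update less_Suc_eq)
  next
    fix s :: state assume "?inv s"
    then show "bfits W ?b s" using W by auto
  next
    fix s :: state assume "?inv s" and "\<not> bval ?b s"
    then show "?inv s \<and> reg s ''i'' = n - 1" by auto
  qed (use that in simp)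
  have final: "wp W ?d ?Q s" if inv: "?inv s" and i: "reg s ''i'' = n - 1" for s :: state
  proof -
    have n2: "n - 2 < n" using n by simp
    have out: "output_edges n s = parent_edges"
      using inv unfolding output_edges_def parent_edges_def length_vs i by (metis (no_types, lifting))
    have "(\<forall>v\<in>{..<n}. pos v + 2 < n \<longrightarrow> (\<exists>u\<in>neighbors E v. pos v < pos u \<and> pos u < top_pos v)) \<longleftrightarrow>
        (\<forall>j<n - 1. j + 2 < n \<longrightarrow> ?two j)" (is "?L \<longleftrightarrow> ?R")
    proof
      assume ?L
      then show ?R using vs_less pos_nth length_vs by (metis add_lessD1 lessThan_iff)
    next
      assume R: ?R
      show ?L
      proof (intro ballI impI)
        fix v assume "v \<in> {..<n}" "pos v + 2 < n"
        then show "\<exists>u\<in>neighbors E v. pos v < pos u \<and> pos u < top_pos v"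
          using R[rule_format, of "pos v"] nth_pos[of v] by simp
      qed
    qed
    \<comment> \<open>\<open>top_pos\<close> never exceeds \<open>n - 1\<close>, so failure of the
      strict test amounts to equality.\<close>
    then have "two_higher_neighbors \<longleftrightarrow> (\<forall>j<n - 1. j + 2 < n \<longrightarrow> ?two j) \<and> \<not> top_pos (vs ! (n - 2)) < n - 1"
      using bounds(2)[OF n2] unfolding two_higher_neighbors_def length_vs by auto
    then show ?thesis
      using inv i out arrays[OF conjunct1[OF inv] n2] bounds[OF n2] vs_less[OF n2] W
      by (auto simp: output_edges_def)
  qed
  have "terminates W write_output (4 + ((bcost ?b + n * (bcost ?b + cost ?c)) + cost ?d)) ?Q s"
    unfolding write_output_def
  proof (rule terminates_Seq[where R = "\<lambda>s. ?inv s \<and> reg s ''i'' = 0"])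
    have "wp W (Seq (Assign ''i'' (Const 0)) (Assign ''answer'' (Const 1))) (\<lambda>s. ?inv s \<and> reg s ''i'' = 0) s"
      using init W n by simp
    from terminates_wp[OF this]
    show "terminates W (Seq (Assign ''i'' (Const 0)) (Assign ''answer'' (Const 1))) 4
        (\<lambda>s. ?inv s \<and> reg s ''i'' = 0) s" by (simp add: eval_nat_numeral)
  next
    fix s1 :: state assume s1: "?inv s1 \<and> reg s1 ''i'' = 0"
    show "terminates W (Seq (While ?b ?c) ?d) ((bcost ?b + n * (bcost ?b + cost ?c)) + cost ?d) ?Q s1"
    proof (rule terminates_Seq)
      show "terminates W (While ?b ?c) (bcost ?b + n * (bcost ?b + cost ?c))
          (\<lambda>s. ?inv s \<and> reg s ''i'' = n - 1) s1"
        using loop[of s1] s1 by simp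
    next
      fix s2 :: state assume "?inv s2 \<and> reg s2 ''i'' = n - 1"
      then show "terminates W ?d (cost ?d) ?Q s2" using final terminates_wp by blast
    qed
  qed
  then show ?thesis by (rule terminates_mono) simp
qed

lemma lcst_program:
  "terminates W lcst_program (49 + 212 * n + 90 * length (concat adj))
    (\<lambda>s. reg s ''answer'' = of_bool two_higher_neighbors \<and> output_edges n s = parent_edges)
    (input_state n m adj vs)"
proof -
  have "terminates W lcst_program ((5 + n * 22) + ((7 + (n + length (concat adj)) * 30) +
      ((7 + (n + length (concat adj)) * 60) + (30 + n * 50))))
    (\<lambda>s. reg s ''answer'' = of_bool two_higher_neighbors \<and> output_edges n s = parent_edges)
    (input_state n m adj vs)"
    unfolding lcst_program_def
    by (rule terminates_Seq[OF index_arrays] terminates_Seq[OF for_edges_update_top]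
        terminates_Seq[OF for_edges_update_guide] write_output loaded_input
      | (simp add: input_state_def; fail) | (elim conjE, assumption))+
  then show ?thesis by (rule terminates_mono) simp
qed

end

theorem theorem1:
  shows "\<exists>(P :: com) (K :: nat).
    \<forall>(n :: nat) (m :: nat) (E :: nat set set) (vs :: nat list) (adj :: nat list list).
      3 \<le> n \<longrightarrow> m = card E \<longrightarrow>
      simple_graph {..<n} E \<longrightarrow> strongly_chordal E \<longrightarrow>
      strong_elimination_order {..<n} E vs \<longrightarrow>
      adjacency_lists n E adj \<longrightarrow>
      (\<exists>t s. exec (K * (n + m)) P (input_state n m adj vs) t s \<and>
             t \<le> K * (n + m) \<and>
             (if \<exists>T. locally_connected_spanning_tree {..<n} E T
              then reg s ''answer'' = 1 \<and>
                   locally_connected_spanning_tree {..<n} E (output_edges n s)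
              else reg s ''answer'' = 0))"
\<comment> \<open>With at most \<open>2 * m\<close> adjacency entries the time is at most
  \<open>49 + 212 * n + 180 * m\<close>, which 300 times \<open>n + m\<close> dominates because
  \<open>3 \<le> n\<close>. The same number is large enough as a word bound.\<close>
proof (rule exI[of _ lcst_program], rule exI[of _ 300], intro allI impI)
  fix n m :: nat and E :: "nat set set" and vs :: "nat list" and adj :: "nat list list"
  assume n: "3 \<le> n" and m: "m = card E" and graph: "simple_graph {..<n} E"
    and order: "strong_elimination_order {..<n} E vs" and adj: "adjacency_lists n E adj"
  let ?W = "300 * (n + m)"
  define pos where "pos = inv_into {..<length vs} ((!) vs)"
  have "distinct vs" using order by (simp add: strong_elimination_order_def)
  then have pos: "pos (vs ! i) = i" if "i < length vs" for i
    unfolding pos_def using that by (intro inv_into_f_f) (auto simp: inj_on_nth)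
  have adj_le: "length (concat adj) \<le> 2 * m" using length_concat_adjacency_lists[OF adj graph] m by simp
  interpret lcst_input n E vs pos adj ?W
    by unfold_locales (use n graph order adj pos adj_le in auto)
  obtain t s where s: "exec ?W lcst_program (input_state n m adj vs) t s"
    "t \<le> 49 + 212 * n + 90 * length (concat adj)"
    "reg s ''answer'' = of_bool two_higher_neighbors" "output_edges n s = parent_edges"
    using lcst_program[of m] by (auto simp: terminates_def)
  have "t \<le> ?W" using s(2) adj_le n by simp
  moreover have "two_higher_neighbors \<longleftrightarrow> (\<exists>T. locally_connected_spanning_tree {..<n} E T)"
    using parent_edges_lcst lcst_imp_two_higher_neighbors n length_vs by auto
  moreover have "two_higher_neighbors \<Longrightarrow> locally_connected_spanning_tree {..<n} E parent_edges"
    using parent_edges_lcst n length_vs by auto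
  ultimately show "\<exists>t s. exec ?W lcst_program (input_state n m adj vs) t s \<and> t \<le> ?W \<and>
      (if \<exists>T. locally_connected_spanning_tree {..<n} E T
       then reg s ''answer'' = 1 \<and> locally_connected_spanning_tree {..<n} E (output_edges n s)
       else reg s ''answer'' = 0)"
    using s by (intro exI[of _ t] exI[of _ s]) auto
qed

end
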